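(* Let $A\in\mathbb{C}^{N\times N}$ with $\|A-I\|<1$, let $b\in\mathbb{C}^N$ with $\log(A)b\ne0$, let $M$ be a positive integer, and let $\alpha>0$ satisfy $\|A/\alpha\|\le1$. Assume that the linear-system solver (the LCU, linear combination of unitaries, method) in Step 1 of the algorithm outputs a state $|\tilde{\boldsymbol{x}}\rangle$ such that $\||\boldsymbol{x}\rangle-|\tilde{\boldsymbol{x}}\rangle\|\le\epsilon'$, where $0\le\epsilon'\le1/2$. Let $$\epsilon=\frac{2}{K}\left(\epsilon_{M,A}+\sqrt{M}\,\delta_M\,\epsilon'\right),\qquad K=\|\log(A)|b\rangle\|\,(1-\|A-I\|),$$ and assume that, by an appropriate setting of the parameters $\epsilon'$ and $M$, $\||f\rangle-|\tilde f\rangle\|\le\epsilon$. Then the actual success probability $\tilde p=\frac{C_M^2}{(1+\alpha)^2M}\|\tilde{\boldsymbol{f}}\|^2$ of the algorithm satisfies $$\tilde p\ \ge\ \left(1-\frac{\epsilon}{2}\right)^2\left(\frac{C_MK}{(1+\alpha)M}\right)^2 .$$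
   Context: $\|\cdot\|$ is the Euclidean norm of vectors and the induced operator 2-norm of matrices; $\log(A)$ is the principal logarithm. Let $t_j,s_j$ ($1\le j\le M$) be the nodes and weights of $M$-point Gauss-Legendre quadrature on $[-1,1]$, and set $\tau_j=\frac12t_j+\frac12$, $\omega_j=\frac12 s_j$, $C_M=1/\max_j\omega_j$. The rational function $r_M(x)$ is the $(M,M)$ Padé approximant to $\log(1+x)$, and $$\epsilon_{M,A}=\left|r_M(-\|A-I\|)-\log(1-\|A-I\|)\right|,\qquad \delta_M=\|A-I\|\Big(\sum_{j=1}^M|\omega_j|^2\Big)^{1/2}.$$ The matrix $\boldsymbol{A}\in\mathbb{C}^{NM\times NM}$ is block diagonal with diagonal blocks $\tau_j(A-I)+I$, $j=1,\dots,M$; $\boldsymbol{b}=(b,\dots,b)^T\in\mathbb{C}^{NM}$ ($M$ copies of $b$). The vector $\boldsymbol{x}=(x^{(1)},\dots,x^{(M)})^T$, with $x^{(j)}=[\tau_j(A-I)+I]^{-1}b$, solves $\boldsymbol{A}\boldsymbol{x}=\boldsymbol{b}$. For a nonzero vector $v$, $|v\rangle=v/\|v\|$; in particular $|b\rangle=b/\|b\|$ and $|\boldsymbol{x}\rangle=\boldsymbol{x}/\|\boldsymbol{x}\|$. The state $|\tilde{\boldsymbol{x}}\rangle$ is a unit vector in $\mathbb{C}^{NM}$; $\tilde{\boldsymbol{x}}=(\tilde x^{(1)},\dots,\tilde x^{(M)})^T$, with $\tilde x^{(j)}\in\mathbb{C}^N$, is a nonzero vector with $|\tilde{\boldsymbol{x}}\rangle=\tilde{\boldsymbol{x}}/\|\tilde{\boldsymbol{x}}\|$.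 Define $$\boldsymbol{f}=\frac{1}{\|\boldsymbol{x}\|}\log(A)b,\qquad \tilde{\boldsymbol{f}}=\frac{1}{\|\tilde{\boldsymbol{x}}\|}(A-I)\sum_{j=1}^M\omega_j\tilde x^{(j)},$$ and $|f\rangle=\boldsymbol{f}/\|\boldsymbol{f}\|$ (target state), $|\tilde f\rangle=\tilde{\boldsymbol{f}}/\|\tilde{\boldsymbol{f}}\|$ (actual output state, assumed well defined). The algorithm prepares $|\tilde{\boldsymbol{x}}\rangle$ (Step 1), rotates an ancilla so that its $|0\rangle$ amplitude is $C_M\omega_j$ conditioned on block index $j$ (Step 2), applies Hadamard gates to the block-index register (Step 3; there $M$ is a power of two), applies a block-encoding of $\frac{1}{1+\alpha}(A-I)$ built from a block-encoding of $A/\alpha$ (Step 4), and measures, success meaning that all index and ancilla qubits are found in $0$ (Step 5). The success probability of this procedure is the quantity $\tilde p$ given by the formula in the statement.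
   Formalization: The additional assumption ε ≤ 2 is made; without it the claim fails, e.g. for M = 1, A = diag(1.01, 1.5), b = e₁, α = 2, ε' = 1/2 and x̃ = x, where the right-hand side exceeds p̃. *)

theory Defs
  imports
    "HOL-Analysis.Analysis"
    "HOL-Computational_Algebra.Computational_Algebra"
begin

subsection \<open>Matrices and vectors\<close>

text \<open>
  \<^typ>\<open>complex ^ 'n\<close> is \<open>\<complex>\<^sup>N\<close> with \<open>N = CARD('n)\<close>. A vector of \<open>\<complex>\<^sup>N\<^sup>M\<close> made of \<open>M = CARD('m)\<close> blocks
  is an element of \<^typ>\<open>(complex ^ 'n) ^ 'm\<close>; its library norm is the Euclidean norm of the block
  norms, hence the Euclidean norm on \<open>\<complex>\<^sup>N\<^sup>M\<close>.
\<close>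

definition opnorm :: "complex ^ 'n ^ 'n \<Rightarrow> real" where
  "opnorm A = onorm (\<lambda>v. A *v v)"

definition ket :: "'a::real_normed_vector \<Rightarrow> 'a" where
  "ket v = v /\<^sub>R norm v"

text \<open>
  The type class operations \<open>1\<close>, \<open>*\<close> and \<open>^\<close> act entrywise on \<^typ>\<open>complex ^ 'n ^ 'n\<close>, so the
  power with respect to the matrix product has to be defined separately.
\<close>

definition matrix_power :: "complex ^ 'n ^ 'n \<Rightarrow> nat \<Rightarrow> complex ^ 'n ^ 'n" where
  "matrix_power X k = (((**) X) ^^ k) (mat 1)"

definition matrix_exp :: "complex ^ 'n ^ 'n \<Rightarrow> complex ^ 'n ^ 'n" where
  "matrix_exp X = (\<Sum>k. matrix_power X k /\<^sub>R fact k)"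

definition is_eigenvalue :: "complex ^ 'n ^ 'n \<Rightarrow> complex \<Rightarrow> bool" where
  "is_eigenvalue X z \<longleftrightarrow> (\<exists>v. v \<noteq> 0 \<and> X *v v = z *s v)"

text \<open>
  The principal logarithm: the unique logarithm whose spectrum lies in the open strip
  \<open>-\<pi> < Im z < \<pi>\<close>. It exists whenever \<open>A\<close> has no eigenvalue on the closed negative real axis,
  in particular if \<open>\<parallel>A - I\<parallel> < 1\<close>.
\<close>

definition matrix_log :: "complex ^ 'n ^ 'n \<Rightarrow> complex ^ 'n ^ 'n" where
  "matrix_log A = (THE X. matrix_exp X = A \<and> (\<forall>z. is_eigenvalue X z \<longrightarrow> - pi < Im z \<and> Im z < pi))"


subsection \<open>Gauss-Legendre quadrature\<close>

text \<open>Legendre polynomials via Rodrigues' formula.\<close>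

definition legendre_poly :: "nat \<Rightarrow> real poly" where
  "legendre_poly n = smult (1 / (2 ^ n * fact n)) ((pderiv ^^ n) ([:-1, 0, 1:] ^ n))"

definition lagrange_basis :: "('m::finite \<Rightarrow> real) \<Rightarrow> 'm \<Rightarrow> real poly" where
  "lagrange_basis t j = (\<Prod>i\<in>UNIV - {j}. smult (1 / (t j - t i)) [:- t i, 1:])"

text \<open>
  The \<open>M\<close> nodes are labelled by the index type \<^typ>\<open>'m\<close> (in any order). As \<^term>\<open>t\<close> is
  injective and the Legendre polynomial has degree \<open>M = CARD('m)\<close>, all its roots occur. The weights
  are those of the interpolatory quadrature rule on these nodes.
\<close>

definition gauss_legendre :: "('m::finite \<Rightarrow> real) \<Rightarrow> ('m \<Rightarrow> real) \<Rightarrow> bool" where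
  "gauss_legendre t s \<longleftrightarrow>
     inj t \<and>
     (\<forall>j. poly (legendre_poly CARD('m)) (t j) = 0) \<and>
     (\<forall>j. s j = integral {-1..1} (poly (lagrange_basis t j)))"


subsection \<open>Pade approximants of \<open>log (1 + x)\<close>\<close>

text \<open>
  \<open>p / q\<close> is in lowest terms with \<open>q 0 = 1\<close>, and \<open>f - p / q = O(x\<^sup>m\<^sup>+\<^sup>n\<^sup>+\<^sup>1)\<close>; since \<open>q 0 = 1\<close>, the latter
  is the same as \<open>f q - p = O(x\<^sup>m\<^sup>+\<^sup>n\<^sup>+\<^sup>1)\<close>.
\<close>

definition is_pade :: "nat \<Rightarrow> nat \<Rightarrow> real fps \<Rightarrow> real poly \<times> real poly \<Rightarrow> bool" where
  "is_pade m n f = (\<lambda>(p, q).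
     degree p \<le> m \<and> degree q \<le> n \<and> poly q 0 = 1 \<and> coprime p q \<and>
     (\<forall>k\<le>m + n. fps_nth (f * fps_of_poly q - fps_of_poly p) k = 0))"

text \<open>\<^term>\<open>fps_ln 1\<close> is the Taylor series of \<open>log (1 + x)\<close> at \<open>0\<close>.\<close>

definition pade_log :: "nat \<Rightarrow> real \<Rightarrow> real" where
  "pade_log M x = (case (THE pq. is_pade M M (fps_ln 1) pq) of (p, q) \<Rightarrow> poly p x / poly q x)"


subsection \<open>Quantities of the algorithm\<close>

definition eps_pade :: "nat \<Rightarrow> complex ^ 'n ^ 'n \<Rightarrow> real" where
  "eps_pade M A =
     \<bar>pade_log M (- opnorm (A - mat 1)) - ln (1 - opnorm (A - mat 1))\<bar>"

definition delta_quad :: "('m::finite \<Rightarrow> real) \<Rightarrow> complex ^ 'n ^ 'n \<Rightarrow> real" where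
  "delta_quad \<omega> A = opnorm (A - mat 1) * sqrt (\<Sum>j\<in>UNIV. \<bar>\<omega> j\<bar>\<^sup>2)"

definition block_solution ::
  "('m::finite \<Rightarrow> real) \<Rightarrow> complex ^ 'n ^ 'n \<Rightarrow> complex ^ 'n \<Rightarrow> (complex ^ 'n) ^ 'm" where
  "block_solution \<tau> A b = (\<chi> j. matrix_inv (\<tau> j *\<^sub>R (A - mat 1) + mat 1) *v b)"

text \<open>The unnormalized target vector; \<^term>\<open>x\<close> is the solution of the block system.\<close>

definition target_vec ::
  "complex ^ 'n ^ 'n \<Rightarrow> complex ^ 'n \<Rightarrow> (complex ^ 'n) ^ 'm \<Rightarrow> complex ^ 'n" where
  "target_vec A b x = (1 / norm x) *\<^sub>R (matrix_log A *v b)"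

definition output_vec ::
  "('m::finite \<Rightarrow> real) \<Rightarrow> complex ^ 'n ^ 'n \<Rightarrow> (complex ^ 'n) ^ 'm \<Rightarrow> complex ^ 'n" where
  "output_vec \<omega> A x = (1 / norm x) *\<^sub>R ((A - mat 1) *v (\<Sum>j\<in>UNIV. \<omega> j *\<^sub>R (x $ j)))"

text \<open>Probability of finding all index and ancilla qubits in \<open>0\<close>, for output vector \<^term>\<open>f\<close>.\<close>

definition success_prob :: "nat \<Rightarrow> real \<Rightarrow> real \<Rightarrow> complex ^ 'n \<Rightarrow> real" where
  "success_prob M C \<alpha> f = C\<^sup>2 / ((1 + \<alpha>)\<^sup>2 * real M) * (norm f)\<^sup>2"

end

theory Submission
  imports Defs "HOL-Computational_Algebra.Field_as_Ring"
begin

text \<open>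
  Write \<open>X = A - I\<close>, \<open>a = \<parallel>X\<parallel> < 1\<close>, and let \<open>r(X) = X (\<Sum>\<^sub>j \<omega>\<^sub>j (I + \<tau>\<^sub>j X)\<^sup>-\<^sup>1)\<close> be the quadrature
  approximation of \<open>log (I + X) = X \<integral> (I + \<tau> X)\<^sup>-\<^sup>1 d\<tau>\<close> on \<open>[0, 1]\<close>. The exact solution \<open>x\<close> of the block
  system produces the output \<open>r(X) b / \<parallel>x\<parallel>\<close>, and the output is an \<open>\<delta>\<close>-Lipschitz function of the
  normalised solution. So \<open>\<parallel>f'\<parallel> \<ge> \<parallel>r(X) b\<parallel> / \<parallel>x\<parallel> - \<delta> \<epsilon>'\<close>, and two estimates remain.

  \<^item> \<open>\<parallel>x\<parallel> \<le> \<surd>M \<parallel>b\<parallel> / (1 - a)\<close>, because the nodes lie in \<open>(0, 1)\<close> (lemma \<open>norm_block_solution_le\<close>).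
  \<^item> \<open>\<parallel>log(A) b - r(X) b\<parallel> \<le> \<epsilon>\<^sub>M \<parallel>b\<parallel>\<close> with the scalar error \<open>\<epsilon>\<^sub>M\<close> of the Pade approximant at \<open>-a\<close>
    (lemma \<open>norm_log1p_minus_quadrature_le\<close>).

  With \<open>l = \<parallel>log(A) b\<parallel> / \<parallel>b\<parallel>\<close> and \<open>K = l (1 - a)\<close> they give
  \<open>\<parallel>r(X) b\<parallel> / \<parallel>x\<parallel> \<ge> (l - \<epsilon>\<^sub>M) (1 - a) / \<surd>M \<ge> (K - \<epsilon>\<^sub>M) / \<surd>M\<close>. The first inequality
  uses \<open>l \<ge> \<epsilon>\<^sub>M\<close>: this is where \<open>\<epsilon> \<le> 2\<close> enters, as it says \<open>\<epsilon>\<^sub>M \<le> \<epsilon>\<^sub>M + \<surd>M \<delta> \<epsilon>' \<le> K \<le> l\<close>. Hence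
  \<open>\<surd>M \<parallel>f'\<parallel> \<ge> K - \<epsilon>\<^sub>M - \<surd>M \<delta> \<epsilon>' = K (1 - \<epsilon> / 2) \<ge> 0\<close>, and squaring gives the claim.

  The second estimate rests on a sign. Both \<open>log (1 + x)\<close> and \<open>r(x)\<close> are power series, and
  \<open>log (1 + x) - r(x) = \<Sum>\<^sub>n (-1)\<^sup>n d\<^sub>n x\<^sup>n\<^sup>+\<^sup>1\<close>, where \<open>d\<^sub>n\<close> is the error of the quadrature rule on the
  monomial \<open>\<tau>\<^sup>n\<close>. All \<open>d\<^sub>n\<close> are nonnegative (\<open>moment_defect_nonneg\<close>), so the norm of
  the matrix series is at most \<open>\<Sum>\<^sub>n d\<^sub>n a\<^sup>n\<^sup>+\<^sup>1\<close>, which is the scalar error at \<open>x = -a\<close>. As \<open>d\<^sub>n = 0\<close> for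
  \<open>n < 2 M\<close>, the function \<open>r\<close> is also the \<open>(M, M)\<close> Pade approximant of \<open>log (1 + x)\<close>
  (\<open>pade_log_eq_quadrature\<close>).

  Finally, the principal logarithm is characterised by its spectrum, and the argument above needs it
  as a power series: \<open>matrix_log_eq_series\<close> shows that the series in \<open>A - I\<close> is a logarithm with
  spectrum in the strip, and that no other logarithm has this property.
\<close>

(* $ denotes vector components below, never power series coefficients. *)
unbundle no fps_syntax

section \<open>The Banach algebra of complex matrices\<close>

lemma norm_matrix_vector_le: "norm (A *v v) \<le> opnorm A * norm v"
  unfolding opnorm_def using onorm[OF matrix_vector_mul_bounded_linear] by blast

lemma opnorm_nonneg: "0 \<le> opnorm A"
  unfolding opnorm_def by (rule onorm_pos_le) simp

lemma opnorm_leI: "(\<And>v. norm (A *v v) \<le> c * norm v) \<Longrightarrow> opnorm A \<le> c"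
  unfolding opnorm_def by (rule onorm_le)

lemma norm_vec_smult: "norm (c *s v) = cmod c * norm v" for v :: "complex ^ 'n"
  by (simp add: norm_vec_def L2_set_def norm_mult power_mult_distrib real_sqrt_mult
      flip: sum_distrib_left)

lemma matrix_vector_mult_sum_left:
  "finite S \<Longrightarrow> (\<Sum>i\<in>S. F i) *v v = (\<Sum>i\<in>S. F i *v v)" for v :: "complex ^ 'n"
  by (induction S rule: finite_induct) (auto simp: matrix_vector_mult_add_rdistrib)

text \<open>
  Together with \<open>opnorm_le_norm\<close>, the next two lemmas say that the operator norm and the Euclidean norm
  of the entries are equivalent; completeness and the value of convergent series therefore
  transfer between the two.
\<close>
lemma matrix_entry_le_opnorm: "cmod (A $ i $ j) \<le> opnorm A"
proof -
  have "cmod (A $ i $ j) = cmod ((A *v axis j 1) $ i)"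
    by (simp add: matrix_vector_mult_def axis_def if_distrib cong: if_cong)
  also have "\<dots> \<le> norm (A *v axis j 1)"
    by (rule Finite_Cartesian_Product.norm_nth_le)
  also have "\<dots> \<le> opnorm A * norm (axis j (1::complex))"
    by (rule norm_matrix_vector_le)
  finally show ?thesis by simp
qed

lemma norm_matrix_le_opnorm:
  "norm (A :: complex ^ 'n ^ 'n) \<le> real (CARD('n) * CARD('n)) * opnorm A"
proof -
  have "norm A \<le> (\<Sum>i\<in>UNIV. norm (A $ i))"
    unfolding norm_vec_def by (rule L2_set_le_sum) simp
  also have "\<dots> \<le> (\<Sum>i\<in>(UNIV::'n set). \<Sum>j\<in>(UNIV::'n set). cmod (A $ i $ j))"
    unfolding norm_vec_def by (intro sum_mono L2_set_le_sum) simp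
  also have "\<dots> \<le> (\<Sum>i\<in>(UNIV::'n set). \<Sum>j\<in>(UNIV::'n set). opnorm A)"
    by (intro sum_mono matrix_entry_le_opnorm)
  finally show ?thesis by simp
qed

lemma opnorm_le_norm: "opnorm A \<le> norm A" for A :: "complex ^ 'n ^ 'n"
proof (rule opnorm_leI)
  fix v :: "complex ^ 'n"
  have "cmod ((A *v v) $ i) \<le> norm (A $ i) * norm v" for i
  proof -
    have "cmod ((A *v v) $ i) \<le> (\<Sum>j\<in>UNIV. cmod (A $ i $ j) * cmod (v $ j))"
      unfolding matrix_vector_mult_def by (simp add: sum_norm_le norm_mult)
    also have "\<dots> \<le> norm (A $ i) * norm v"
      unfolding norm_vec_def using L2_set_mult_ineq[of "\<lambda>j. cmod (A $ i $ j)" "\<lambda>j. cmod (v $ j)" UNIV]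
      by simp
    finally show ?thesis .
  qed
  then have "norm (A *v v) \<le> L2_set (\<lambda>i. norm (A $ i) * norm v) UNIV"
    unfolding norm_vec_def[of "A *v v"] by (intro L2_set_mono) auto
  also have "\<dots> = norm A * norm v"
    unfolding norm_vec_def[of A] by (simp add: L2_set_left_distrib)
  finally show "norm (A *v v) \<le> norm A * norm v" .
qed

lemma scaleR_matrix_vector: "(r *\<^sub>R A) *v v = r *\<^sub>R (A *v v)" for v :: "complex ^ 'n"
  by (simp add: vec_eq_iff matrix_vector_mult_def scaleR_sum_right)

lemma matrix_add_right_distrib: "(A + B) ** C = A ** C + B ** C"
  for A B C :: "complex ^ 'n ^ 'n"
  by (vector matrix_matrix_mult_def sum.distrib algebra_simps)

text \<open>
  A copy of the matrix type whose multiplication is the matrix product and whose norm is the operator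
  norm. It is a Banach algebra, so that the theory of \<open>exp\<close>, power series and derivatives
  in Banach algebras applies to matrices.
\<close>
typedef 'n cmat = "UNIV :: (complex ^ 'n::finite ^ 'n) set"
  morphisms mat_of of_mat ..

setup_lifting type_definition_cmat

instantiation cmat :: (finite) real_normed_algebra_1
begin

lift_definition zero_cmat :: "'a cmat" is 0 .
lift_definition one_cmat :: "'a cmat" is "mat 1" .
lift_definition plus_cmat :: "'a cmat \<Rightarrow> 'a cmat \<Rightarrow> 'a cmat" is "(+)" .
lift_definition minus_cmat :: "'a cmat \<Rightarrow> 'a cmat \<Rightarrow> 'a cmat" is "(-)" .
lift_definition uminus_cmat :: "'a cmat \<Rightarrow> 'a cmat" is uminus .
lift_definition times_cmat :: "'a cmat \<Rightarrow> 'a cmat \<Rightarrow> 'a cmat" is "(**)" .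
lift_definition scaleR_cmat :: "real \<Rightarrow> 'a cmat \<Rightarrow> 'a cmat" is scaleR .
lift_definition norm_cmat :: "'a cmat \<Rightarrow> real" is opnorm .

definition dist_cmat :: "'a cmat \<Rightarrow> 'a cmat \<Rightarrow> real"
  where "dist_cmat a b = norm (a - b)"

definition sgn_cmat :: "'a cmat \<Rightarrow> 'a cmat"
  where "sgn_cmat x = scaleR (inverse (norm x)) x"

definition uniformity_cmat :: "('a cmat \<times> 'a cmat) filter"
  where "uniformity_cmat = (INF e\<in>{0 <..}. principal {(x, y). dist x y < e})"

definition open_cmat :: "'a cmat set \<Rightarrow> bool"
  where "open_cmat S = (\<forall>x\<in>S. \<forall>\<^sub>F (x', y) in uniformity. x' = x \<longrightarrow> y \<in> S)"

instance
proof
  fix x y :: "'a cmat" and r :: real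
  show "(norm x = 0) = (x = 0)"
  proof (transfer)
    fix x :: "complex ^ 'a ^ 'a"
    have "opnorm x = 0 \<longleftrightarrow> (\<forall>v. x *v v = 0)"
      unfolding opnorm_def by (rule onorm_eq_0) simp
    also have "\<dots> \<longleftrightarrow> x = 0"
      by (metis matrix_eq matrix_vector_mult_0)
    finally show "opnorm x = 0 \<longleftrightarrow> x = 0" .
  qed
  show "norm (x + y) \<le> norm x + norm y"
    by transfer (simp add: opnorm_def matrix_vector_mult_add_rdistrib onorm_triangle)
  show "norm (r *\<^sub>R x) = \<bar>r\<bar> * norm x"
    by transfer (simp add: opnorm_def scaleR_matrix_vector onorm_scaleR)
  show "norm (x * y) \<le> norm x * norm y"
    by transfer (use onorm_compose[OF matrix_vector_mul_bounded_linear matrix_vector_mul_bounded_linear]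
        in \<open>simp add: opnorm_def o_def matrix_vector_mul_assoc\<close>)
  show "norm (1 :: 'a cmat) = 1"
    by transfer (simp add: opnorm_def onorm_id)
  show "(0 :: 'a cmat) \<noteq> 1"
    by transfer (auto simp: mat_def vec_eq_iff)
  show "r *\<^sub>R x * y = r *\<^sub>R (x * y)" "x * r *\<^sub>R y = r *\<^sub>R (x * y)"
    by (transfer, vector matrix_matrix_mult_def scaleR_sum_right)+
qed (unfold dist_cmat_def sgn_cmat_def uniformity_cmat_def open_cmat_def,
    (rule refl | (transfer, simp add: matrix_mul_assoc algebra_simps matrix_add_ldistrib matrix_add_right_distrib))+)

end

lemma bounded_linear_mat_of: "bounded_linear (mat_of :: 'n::finite cmat \<Rightarrow> _)"
proof (rule bounded_linear_intro)
  show "norm (mat_of x) \<le> norm x * real (CARD('n) * CARD('n))" for x :: "'n cmat"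
    by transfer (use norm_matrix_le_opnorm in \<open>simp add: mult_ac\<close>)
qed (transfer, simp)+

lemma bounded_linear_of_mat: "bounded_linear (of_mat :: _ \<Rightarrow> 'n::finite cmat)"
proof (rule bounded_linear_intro)
  show "norm (of_mat x :: 'n cmat) \<le> norm x * 1" for x
    by transfer (simp add: opnorm_le_norm)
qed (transfer, simp)+

instance cmat :: (finite) banach
proof
  fix X :: "nat \<Rightarrow> 'a cmat"
  assume "Cauchy X"
  then have "Cauchy (\<lambda>n. mat_of (X n))"
    by (rule bounded_linear.Cauchy[OF bounded_linear_mat_of])
  then obtain L where "(\<lambda>n. mat_of (X n)) \<longlonglongrightarrow> L"
    using Cauchy_convergent convergentD by blast
  then have "(\<lambda>n. of_mat (mat_of (X n))) \<longlonglongrightarrow> (of_mat L :: 'a cmat)"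
    by (rule bounded_linear.tendsto[OF bounded_linear_of_mat])
  then show "convergent X"
    by (auto simp: mat_of_inverse convergent_def)
qed

lemma mat_of_simps:
  "mat_of 0 = 0" "mat_of 1 = mat 1" "mat_of (X + Y) = mat_of X + mat_of Y"
  "mat_of (X - Y) = mat_of X - mat_of Y" "mat_of (- X) = - mat_of X"
  "mat_of (X * Y) = mat_of X ** mat_of Y" "mat_of (r *\<^sub>R X) = r *\<^sub>R mat_of X"
  "opnorm (mat_of X) = norm X"
  by (transfer; simp)+

lemma mat_of_power: "mat_of (X ^ k) = matrix_power (mat_of X) k"
  by (induction k) (simp_all add: matrix_power_def mat_of_simps)

lemma mat_of_exp: "mat_of (exp X) = matrix_exp (mat_of X)"
  unfolding exp_def matrix_exp_def
  using bounded_linear.suminf[OF bounded_linear_mat_of summable_exp_generic[of X]]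
  by (simp add: mat_of_simps mat_of_power)

section \<open>The logarithm series in a Banach algebra\<close>

lemma geometric_series_inverse:
  fixes Y :: "'a::{real_normed_algebra_1,banach}"
  assumes "norm Y < 1"
  shows "(\<Sum>n. Y ^ n) * (1 - Y) = 1"
proof -
  have "(\<lambda>n. Y ^ n) \<longlonglongrightarrow> 0"
    by (rule summable_LIMSEQ_zero[OF complete_algebra_summable_geometric[OF assms]])
  from telescope_sums'[OF this] have "(\<lambda>n. Y ^ n * (1 - Y)) sums 1"
    by (simp add: algebra_simps power_commutes)
  moreover have "(\<lambda>n. Y ^ n * (1 - Y)) sums ((\<Sum>n. Y ^ n) * (1 - Y))"
    by (intro sums_mult2 summable_sums complete_algebra_summable_geometric assms)
  ultimately show ?thesis using sums_unique2 by blast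
qed

text \<open>
  \<open>log (1 + X)\<close>, uniformly for real and complex numbers and for matrices: the error estimate compares
  the series at a matrix with the series at a real number.
\<close>
definition log1p_series :: "'a::{real_normed_algebra_1,banach} \<Rightarrow> 'a" where
  "log1p_series X = (\<Sum>n. ((-1) ^ n / (real n + 1)) *\<^sub>R X ^ Suc n)"

text \<open>
  One power of \<open>a\<close> is given away, so that the majorant is the geometric series itself.
\<close>
lemma norm_bounded_series_le:
  fixes X :: "'a::real_normed_algebra_1"
  assumes "\<bar>c\<bar> \<le> 1" "norm X \<le> a" "a < 1"
  shows "norm (c *\<^sub>R X ^ Suc n) \<le> a ^ n"
proof -
  have "norm (c *\<^sub>R X ^ Suc n) \<le> 1 * norm X ^ Suc n"
    unfolding norm_scaleR using assms(1) norm_power_ineq[of X "Suc n"] by (intro mult_mono) auto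
  also have "\<dots> \<le> a ^ Suc n"
    using assms by (simp add: power_mono del: power_Suc)
  also have "\<dots> \<le> a ^ n"
    using assms order.trans[OF norm_ge_zero assms(2)] by (simp add: mult_left_le_one_le)
  finally show ?thesis .
qed

lemma summable_bounded_series:
  fixes X :: "'a::{real_normed_algebra_1,banach}"
  assumes "norm X < 1" "\<And>n. \<bar>c n\<bar> \<le> 1"
  shows "summable (\<lambda>n. c n *\<^sub>R X ^ Suc n)"
proof (rule summable_comparison_test')
  show "summable (\<lambda>n. norm X ^ n)" using assms by (simp add: summable_geometric)
  show "norm (c n *\<^sub>R X ^ Suc n) \<le> norm X ^ n" if "n \<ge> 0" for n
    using assms by (intro norm_bounded_series_le) auto
qed

lemma abs_log_coeff_le: "\<bar>(-1) ^ n / (real n + 1)\<bar> \<le> 1"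
  by (simp add: power_abs abs_divide)

lemma summable_log1p_series:
  "norm X < 1 \<Longrightarrow> summable (\<lambda>n. ((-1) ^ n / (real n + 1)) *\<^sub>R X ^ Suc n)"
  for X :: "'a::{real_normed_algebra_1,banach}"
  by (intro summable_bounded_series abs_log_coeff_le)

lemma log1p_series_commute:
  fixes X Y :: "'a::{real_normed_algebra_1,banach}"
  assumes "norm X < 1" "X * Y = Y * X"
  shows "log1p_series X * Y = Y * log1p_series X"
proof -
  have "X ^ Suc n * Y = Y * X ^ Suc n" for n
    using assms(2) by (rule power_commuting_commutes)
  then show ?thesis
    unfolding log1p_series_def suminf_mult2[OF summable_log1p_series[OF assms(1)]]
      suminf_mult[OF summable_log1p_series[OF assms(1)], symmetric]
    by (simp del: power_Suc)
qed

text \<open>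
  Along the ray \<open>t X\<close> the terms are real multiples of fixed elements, so the series can be differentiated
  termwise; the series of derivatives is dominated by the geometric series on the whole of \<open>[0, 1]\<close>.
\<close>
lemma log1p_series_has_vector_derivative:
  fixes X :: "'a::{real_normed_algebra_1,banach}"
  assumes "norm X < 1" "t \<in> {0..1}"
  shows "((\<lambda>t. log1p_series (t *\<^sub>R X)) has_vector_derivative (\<Sum>n. ((-1) ^ n * t ^ n) *\<^sub>R X ^ Suc n))
    (at t within {0..1})"
proof -
  define f where "f n t = ((-1) ^ n / (real n + 1)) *\<^sub>R (t *\<^sub>R X) ^ Suc n" for n t
  define d where "d n t = ((-1) ^ n * t ^ n) *\<^sub>R X ^ Suc n" for n t
  have f_alt: "f n t = ((-1) ^ n * t ^ Suc n / (real n + 1)) *\<^sub>R X ^ Suc n" for n t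
    by (simp add: f_def scaleR_power del: power_Suc)
  have small: "norm (t *\<^sub>R X) < 1" if "t \<in> {0..1}" for t :: real
    using that assms(1) mult_left_le_one_le[of "norm X" t] by auto
  have f_sums: "(\<lambda>n. f n t) sums log1p_series (t *\<^sub>R X)" if "t \<in> {0..1}" for t
    unfolding f_def log1p_series_def using small[OF that] by (intro summable_sums summable_log1p_series)
  have "uniform_limit {0..1} (\<lambda>n t. \<Sum>i<n. d i t) (\<lambda>t. \<Sum>i. d i t) sequentially"
  proof (rule Weierstrass_m_test)
    show "norm (d n t) \<le> norm X ^ n" if "t \<in> {0..1}" for n t
      unfolding d_def using that assms(1)
      by (intro norm_bounded_series_le) (auto simp: abs_mult power_abs power_le_one)
    show "summable (\<lambda>n. norm X ^ n)" using assms by (simp add: summable_geometric)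
  qed
  note unif = this
  have "\<exists>g. \<forall>t\<in>{0..1}. (\<lambda>n. f n t) sums g t \<and>
      (g has_derivative (\<lambda>h. h *\<^sub>R (\<Sum>i. d i t))) (at t within {0..1})"
  proof (rule has_derivative_series)
    show "(f n has_derivative (\<lambda>h. h *\<^sub>R d n t)) (at t within {0..1})" for n t
    proof -
      have "((\<lambda>t. ((-1) ^ n * t ^ Suc n / (real n + 1)) *\<^sub>R X ^ Suc n) has_vector_derivative d n t) (at t within {0..1})"
        unfolding d_def
        by (rule derivative_eq_intros refl | simp add: add.commute del: power_Suc of_nat_Suc)+
          (simp add: field_simps)
      then show ?thesis
        unfolding has_vector_derivative_def f_alt[abs_def] .
    qed
    show "\<forall>\<^sub>F n in sequentially. \<forall>t\<in>{0..1}. \<forall>h.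
        norm ((\<Sum>i<n. h *\<^sub>R d i t) - h *\<^sub>R (\<Sum>i. d i t)) \<le> e * norm h" if "0 < e" for e :: real
      using uniform_limitD[OF unif that]
    proof eventually_elim
      case (elim n)
      show ?case
      proof (intro ballI allI)
        fix t h :: real assume "t \<in> {0..1}"
        then have "norm ((\<Sum>i<n. d i t) - (\<Sum>i. d i t)) \<le> e"
          using elim by (auto simp: dist_norm less_imp_le)
        then show "norm ((\<Sum>i<n. h *\<^sub>R d i t) - h *\<^sub>R (\<Sum>i. d i t)) \<le> e * norm h"
          by (simp add: mult_left_mono mult.commute[of e] flip: scaleR_sum_right scaleR_diff_right)
      qed
    qed
    show "(\<lambda>n. f n t) sums log1p_series (t *\<^sub>R X)" by (rule f_sums) fact
  qed (use assms in auto)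
  then obtain g where g: "\<And>t. t \<in> {0..1} \<Longrightarrow> (\<lambda>n. f n t) sums g t"
    "\<And>t. t \<in> {0..1} \<Longrightarrow> (g has_vector_derivative (\<Sum>i. d i t)) (at t within {0..1})"
    unfolding has_vector_derivative_def by blast
  have "log1p_series (t *\<^sub>R X) = g t" if "t \<in> {0..1}" for t
    using f_sums[OF that] g(1)[OF that] sums_unique2 by blast
  then have "((\<lambda>t. log1p_series (t *\<^sub>R X)) has_vector_derivative (\<Sum>i. d i t)) (at t within {0..1})"
    by (rule has_vector_derivative_transform[OF assms(2) _ g(2)[OF assms(2)]])
  then show ?thesis by (simp only: d_def)
qed

lemma exp_second_order_bound:
  fixes h :: "'a::{real_normed_algebra_1,banach}"
  assumes "norm h \<le> 1"
  shows "norm (exp h - 1 - h) \<le> (norm h)\<^sup>2"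
proof -
  have split: "exp x - 1 - x = (\<Sum>n. x ^ (n + 2) /\<^sub>R fact (n + 2))"
    for x :: "'b::{real_normed_algebra_1,banach}"
    using suminf_minus_initial_segment[OF summable_exp_generic[of x], of 2]
    by (simp add: exp_def numeral_2_eq_2 algebra_simps)
  have "norm (exp h - 1 - h) \<le> (\<Sum>n. norm (h ^ (n + 2) /\<^sub>R fact (n + 2)))"
    unfolding split by (intro summable_norm summable_ignore_initial_segment[OF summable_norm_exp])
  also have "\<dots> \<le> (\<Sum>n. norm h ^ (n + 2) /\<^sub>R fact (n + 2))"
  proof (rule suminf_le)
    show "norm (h ^ (n + 2) /\<^sub>R fact (n + 2)) \<le> norm h ^ (n + 2) /\<^sub>R fact (n + 2)" for n
      using norm_power_ineq[of h "n + 2"] by (simp add: divide_right_mono del: power_Suc)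
  qed (intro summable_ignore_initial_segment[OF summable_norm_exp]
      summable_ignore_initial_segment[OF summable_exp_generic])+
  also have "\<dots> = exp (norm h) - 1 - norm h" unfolding split ..
  also have "\<dots> \<le> (norm h)\<^sup>2" using exp_bound[of "norm h"] assms by simp
  finally show ?thesis .
qed

lemma exp_has_derivative_0: "(exp has_derivative (\<lambda>h. h)) (at (0::'a::{real_normed_algebra_1,banach}))"
  unfolding has_derivative_iff_norm
proof (intro conjI)
  show "((\<lambda>y::'a. norm (exp y - exp 0 - (y - 0)) / norm (y - 0)) \<longlongrightarrow> 0) (at 0)"
  proof (rule Lim_null_comparison)
    show "((\<lambda>y::'a. norm y) \<longlongrightarrow> 0) (at 0)" by (rule tendsto_norm_zero) (rule tendsto_ident_at)
    have "\<forall>\<^sub>F y::'a in at 0. norm y < 1"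
      using eventually_at_ball[of 1 "0::'a" UNIV] by (simp add: dist_norm)
    then show "\<forall>\<^sub>F y::'a in at 0. norm (norm (exp y - exp 0 - (y - 0)) / norm (y - 0)) \<le> norm y"
      by eventually_elim
        (use exp_second_order_bound[where 'a = 'a] in \<open>auto simp: divide_le_eq power2_eq_square less_imp_le\<close>)
  qed
qed (simp add: bounded_linear_ident)

text \<open>
  The chain rule for \<open>exp\<close> fails in a noncommutative algebra, but it holds along commuting
  families, since there \<open>exp (f s) = exp (f t) exp (f s - f t)\<close> and only the derivative of \<open>exp\<close> at
  \<open>0\<close> is needed.
\<close>
lemma exp_has_vector_derivative_commuting:
  fixes f :: "real \<Rightarrow> 'a::{real_normed_algebra_1,banach}"
  assumes f: "(f has_vector_derivative D) (at t within S)" and "t \<in> S"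
    and comm: "\<And>s. s \<in> S \<Longrightarrow> f s * f t = f t * f s"
  shows "((\<lambda>s. exp (f s)) has_vector_derivative exp (f t) * D) (at t within S)"
proof -
  have "((\<lambda>s. f s - f t) has_vector_derivative D - 0) (at t within S)"
    by (intro has_vector_derivative_diff f has_vector_derivative_const)
  then have diff: "((\<lambda>s. f s - f t) has_derivative (\<lambda>h. h *\<^sub>R D)) (at t within S)"
    unfolding has_vector_derivative_def diff_0_right .
  have "(exp has_derivative (\<lambda>h. h)) (at (f t - f t))"
    using exp_has_derivative_0[where 'a = 'a] by simp
  from has_derivative_compose[OF diff this]
  have "((\<lambda>s. exp (f s - f t)) has_derivative (\<lambda>h. h *\<^sub>R D)) (at t within S)" .
  then have "((\<lambda>s. exp (f t) * exp (f s - f t)) has_derivative (\<lambda>h. exp (f t) * (h *\<^sub>R D))) (at t within S)"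
    by (rule has_derivative_mult_right)
  then have "((\<lambda>s. exp (f t) * exp (f s - f t)) has_vector_derivative exp (f t) * D) (at t within S)"
    by (simp add: has_vector_derivative_def)
  note deriv = this
  have eq: "exp (f s) = exp (f t) * exp (f s - f t)" if "s \<in> S" for s
  proof -
    have "f t * (f s - f t) = (f s - f t) * f t"
      unfolding left_diff_distrib right_diff_distrib comm[OF that] ..
    from exp_add_commuting[OF this] show ?thesis by simp
  qed
  show ?thesis
    by (rule has_vector_derivative_transform[OF \<open>t \<in> S\<close> eq deriv])
qed

text \<open>
  With \<open>L(t) = log (1 + t X)\<close> one has \<open>L'(t) (1 + t X) = X\<close>, so \<open>exp (- L(t)) (1 + t X)\<close> has
  derivative \<open>0\<close> and keeps its value \<open>1\<close> from \<open>t = 0\<close> to \<open>t = 1\<close>.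
\<close>
lemma exp_log1p_series:
  fixes X :: "'a::{real_normed_algebra_1,banach}"
  assumes "norm X < 1"
  shows "exp (log1p_series X) = 1 + X"
proof -
  define L where "L t = log1p_series (t *\<^sub>R X)" for t
  define D where "D t = (\<Sum>n. ((-1) ^ n * t ^ n) *\<^sub>R X ^ Suc n)" for t :: real
  have small: "norm (t *\<^sub>R X) < 1" if "t \<in> {0..1}" for t :: real
    using that assms(1) mult_left_le_one_le[of "norm X" t] by auto
  have D_eq: "D t * (1 + t *\<^sub>R X) = X" if "t \<in> {0..1}" for t
  proof -
    have small': "norm (- (t *\<^sub>R X)) < 1" using small[OF that] by simp
    have "(- (t *\<^sub>R X)) ^ n = ((-1) ^ n * t ^ n) *\<^sub>R X ^ n" for n
      using scaleR_power[of "- t" X n] by (simp add: power_minus[of t])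
    then have "D t = (\<Sum>n. X * (- (t *\<^sub>R X)) ^ n)"
      by (simp add: D_def)
    also have "\<dots> = X * (\<Sum>n. (- (t *\<^sub>R X)) ^ n)"
      by (intro suminf_mult complete_algebra_summable_geometric small')
    finally show ?thesis
      using geometric_series_inverse[OF small'] by (simp add: mult.assoc)
  qed
  have L_comm: "L s * L t = L t * L s" if "s \<in> {0..1}" "t \<in> {0..1}" for s t
  proof -
    have "L s * (t *\<^sub>R X) = (t *\<^sub>R X) * L s"
      unfolding L_def by (rule log1p_series_commute[OF small[OF that(1)]]) (simp add: mult.commute)
    from log1p_series_commute[OF small[OF that(2)] this[symmetric]] show ?thesis
      unfolding L_def by simp
  qed
  have deriv: "((\<lambda>s. exp (- L s) * (1 + s *\<^sub>R X)) has_vector_derivative 0) (at t within {0..1})"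
    if t: "t \<in> {0..1}" for t
  proof -
    have "((\<lambda>s. - L s) has_vector_derivative - D t) (at t within {0..1})"
      unfolding L_def D_def
      by (rule has_vector_derivative_minus[OF log1p_series_has_vector_derivative[OF assms t]])
    then have "((\<lambda>s. exp (- L s)) has_vector_derivative exp (- L t) * - D t) (at t within {0..1})"
      using L_comm t by (intro exp_has_vector_derivative_commuting) auto
    moreover have "((\<lambda>s. 1 + s *\<^sub>R X) has_vector_derivative X) (at t within {0..1})"
      by (auto intro!: derivative_eq_intros)
    ultimately have "((\<lambda>s. exp (- L s) * (1 + s *\<^sub>R X)) has_vector_derivative
        exp (- L t) * X + exp (- L t) * - D t * (1 + t *\<^sub>R X)) (at t within {0..1})"
      by (rule has_vector_derivative_mult)
    moreover have "exp (- L t) * X + exp (- L t) * - D t * (1 + t *\<^sub>R X) = 0"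
      using D_eq[OF t] by (simp add: mult.assoc)
    ultimately show ?thesis by simp
  qed
  define H where "H s = exp (- L s) * (1 + s *\<^sub>R X)" for s
  have "(H has_derivative (\<lambda>h. 0)) (at t within {0..1})" if "t \<in> {0..1}" for t
    using deriv[OF that] unfolding H_def[abs_def] has_vector_derivative_def scaleR_zero_right .
  then have "\<exists>c. \<forall>t\<in>{0..1}. H t = c"
    by (rule has_derivative_zero_constant[OF convex_real_interval(5)])
  then have "H 1 = H 0" by auto
  then have "exp (- log1p_series X) * (1 + X) = 1"
    by (simp add: H_def L_def log1p_series_def)
  then have "exp (log1p_series X) * exp (- log1p_series X) * (1 + X) = exp (log1p_series X)"
    by (simp only: mult.assoc mult_1_right)
  then show ?thesis by (simp add: exp_minus_inverse)
qed

text \<open>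
  The entire function \<open>(exp z - 1) / z\<close>. It detects, on eigenvectors, how an element with exponential
  \<open>1\<close> can differ from \<open>0\<close>.
\<close>
definition exp_quotient :: "'a::{real_normed_algebra_1,banach} \<Rightarrow> 'a" where
  "exp_quotient Z = (\<Sum>n. (1 / fact (Suc n)) *\<^sub>R Z ^ n)"

lemma summable_exp_quotient: "summable (\<lambda>n. (1 / fact (Suc n)) *\<^sub>R Z ^ n)"
  for Z :: "'a::{real_normed_algebra_1,banach}"
proof (rule summable_comparison_test')
  show "summable (\<lambda>n. norm (Z ^ n /\<^sub>R fact n))" by (rule summable_norm_exp)
  show "norm ((1 / fact (Suc n)) *\<^sub>R Z ^ n) \<le> norm (Z ^ n /\<^sub>R fact n)" if "n \<ge> 0" for n
    using fact_mono[of n "Suc n", where 'a = real]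
    by (simp add: divide_inverse mult_right_mono le_imp_inverse_le del: fact_Suc)
qed

lemma exp_quotient_mult: "exp_quotient Z * Z = exp Z - 1"
  for Z :: "'a::{real_normed_algebra_1,banach}"
proof -
  have "exp_quotient Z * Z = (\<Sum>n. Z ^ Suc n /\<^sub>R fact (Suc n))"
    unfolding exp_quotient_def
    by (subst suminf_mult2[OF summable_exp_quotient]) (simp add: power_commutes divide_inverse)
  also have "\<dots> = exp Z - 1"
    using suminf_split_head[OF summable_exp_generic[of Z]] by (simp add: exp_def)
  finally show ?thesis .
qed

lemma exp_quotient_0: "exp_quotient (0 :: 'a::{real_normed_algebra_1,banach}) = 1"
proof -
  have "exp_quotient (0 :: 'a) = (\<Sum>n\<in>{0}. (1 / fact (Suc n)) *\<^sub>R 0 ^ n)"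
    unfolding exp_quotient_def by (rule suminf_finite) (auto simp: power_0_left)
  then show ?thesis by simp
qed

section \<open>Common eigenvectors of commuting matrices\<close>

text \<open>
  \<open>p(A) w\<close>, evaluated by Horner's scheme.
\<close>
definition poly_action :: "complex ^ 'n ^ 'n \<Rightarrow> complex poly \<Rightarrow> complex ^ 'n \<Rightarrow> complex ^ 'n" where
  "poly_action A p w = fold_coeffs (\<lambda>c u. c *s w + A *v u) p 0"

lemma poly_action_0 [simp]: "poly_action A 0 w = 0"
  by (simp add: poly_action_def)

lemma poly_action_pCons [simp]: "poly_action A (pCons c p) w = c *s w + A *v poly_action A p w"
  unfolding poly_action_def by (cases "c = 0 \<and> p = 0") auto

lemma poly_action_add: "poly_action A (p + q) w = poly_action A p w + poly_action A q w"
  by (induction p q rule: poly_induct2)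
    (simp_all add: vector_sadd_rdistrib matrix_vector_right_distrib ac_simps)

lemma poly_action_smult: "poly_action A (smult c p) w = c *s poly_action A p w"
  by (induction p) (simp_all add: vec.scale_right_distrib vec.scale)

lemma poly_action_sum: "finite S \<Longrightarrow> poly_action A (\<Sum>i\<in>S. f i) w = (\<Sum>i\<in>S. poly_action A (f i) w)"
  by (induction S rule: finite_induct) (auto simp: poly_action_add)

lemma poly_action_monom: "poly_action A (monom c n) w = c *s (((*v) A) ^^ n) w"
  by (induction n) (simp_all add: monom_Suc monom_0 vec.scale)

lemma poly_action_in_subspace:
  assumes "vec.subspace W" "\<And>w. w \<in> W \<Longrightarrow> A *v w \<in> W" "w \<in> W"
  shows "poly_action A p w \<in> W"
  using assms by (induction p) (auto intro: vec.subspace_add vec.subspace_scale vec.subspace_0)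

text \<open>
  \<open>w, A w, \<dots>, A\<^sup>N w\<close> are \<open>N + 1\<close> vectors of an \<open>N\<close>-dimensional space. A repetition among them has to be
  treated separately, since it is lost when the vectors are collected in a set.
\<close>
lemma ex_annihilating_poly:
  fixes A :: "complex ^ 'n ^ 'n"
  shows "\<exists>p. p \<noteq> 0 \<and> poly_action A p w = 0"
proof -
  define v where "v i = (((*v) A) ^^ i) w" for i
  define S where "S = v ` {..CARD('n)}"
  show ?thesis
  proof (cases "inj_on v {..CARD('n)}")
    case True
    then have "card S = CARD('n) + 1" by (simp add: S_def card_image)
    moreover have "vec.dim S \<le> CARD('n)" 
      using vec.dim_subset[of S UNIV] by (simp add: card_cart_basis)
    ultimately have "vec.dependent S" by (intro vec.dependent_biggerset_general) simp
    then obtain u where u: "(\<Sum>x\<in>S. u x *s x) = 0" "\<exists>x\<in>S. u x \<noteq> 0"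
      using vec.dependent_finite[of S] by (auto simp: S_def)
    define p where "p = (\<Sum>i\<le>CARD('n). monom (u (v i)) i)"
    have "poly_action A p w = (\<Sum>i\<le>CARD('n). u (v i) *s v i)"
      by (simp add: p_def poly_action_sum poly_action_monom v_def)
    also have "\<dots> = (\<Sum>x\<in>S. u x *s x)"
      unfolding S_def using True by (simp add: sum.reindex)
    finally have "poly_action A p w = 0" using u(1) by simp
    moreover obtain i where "i \<le> CARD('n)" "u (v i) \<noteq> 0" using u(2) by (auto simp: S_def)
    then have "coeff p i \<noteq> 0" by (simp add: p_def coeff_sum if_distrib cong: if_cong)
    then have "p \<noteq> 0" by auto
    ultimately show ?thesis by blast
  next
    case False
    then obtain i j where ij: "i \<noteq> j" "v i = v j" by (auto simp: inj_on_def)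
    define p where "p = monom 1 i + monom (-1::complex) j"
    have "poly_action A p w = 0"
      using ij(2) by (simp add: p_def poly_action_add poly_action_monom v_def)
    moreover have "coeff p i \<noteq> 0" using ij(1) by (simp add: p_def)
    then have "p \<noteq> 0" by auto
    ultimately show ?thesis by blast
  qed
qed

text \<open>
  Take a nonzero polynomial \<open>p\<close> of least degree with \<open>p(A) w = 0\<close> and split off a linear factor,
  \<open>p = (x - z) q\<close>. By minimality \<open>q(A) w \<noteq> 0\<close>, and this is an eigenvector. Unlike an argument by
  the characteristic polynomial, this stays inside the invariant subspace.
\<close>
lemma ex_eigenvector_in_subspace:
  fixes A :: "complex ^ 'n ^ 'n"
  assumes W: "vec.subspace W" and inv: "\<And>w. w \<in> W \<Longrightarrow> A *v w \<in> W" and w: "w \<in> W" "w \<noteq> 0"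
  shows "\<exists>v z. v \<in> W \<and> v \<noteq> 0 \<and> A *v v = z *s v"
proof -
  define P where "P p \<longleftrightarrow> p \<noteq> 0 \<and> poly_action A p w = 0" for p
  obtain p0 where "P p0" using ex_annihilating_poly[of A w] unfolding P_def by blast
  define p where "p = arg_min degree P"
  have p: "P p" and min: "\<And>q. P q \<Longrightarrow> degree p \<le> degree q"
    unfolding p_def using \<open>P p0\<close> by (auto intro: arg_min_natI arg_min_nat_le)
  have "degree p \<noteq> 0"
  proof
    assume "degree p = 0"
    then obtain c where "p = [:c:]" by (elim degree_eq_zeroE)
    then show False using p w(2) by (simp add: P_def)
  qed
  then obtain z where "poly p z = 0"
    using fundamental_theorem_of_algebra[of p] by (auto simp: constant_degree)
  then obtain q where q: "p = [:- z, 1:] * q" by (auto simp: poly_eq_0_iff_dvd elim: dvdE)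
  have "q \<noteq> 0" using p q by (auto simp: P_def)
  then have "degree p = Suc (degree q)" unfolding q by (simp add: degree_mult_eq del: mult_pCons_left)
  then have ne: "poly_action A q w \<noteq> 0" using min[of q] \<open>q \<noteq> 0\<close> by (auto simp: P_def)
  have "p = smult (- z) q + pCons 0 q" unfolding q by simp
  then have "poly_action A p w = (- z) *s poly_action A q w + A *v poly_action A q w"
    by (simp only: poly_action_add poly_action_smult poly_action_pCons) simp
  then have "A *v poly_action A q w = z *s poly_action A q w"
    using p by (simp add: P_def vector_smult_lneg)
  moreover have "poly_action A q w \<in> W" using W inv w(1) by (rule poly_action_in_subspace)
  ultimately show ?thesis using ne by blast
qed

text \<open>
  An eigenspace of one matrix inside \<open>W\<close> is invariant under every matrix that commutes with it.
\<close>
lemma ex_common_eigenvector_in_subspace: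
  fixes A B :: "complex ^ 'n ^ 'n"
  assumes W: "vec.subspace W" and invA: "\<And>w. w \<in> W \<Longrightarrow> A *v w \<in> W"
    and invB: "\<And>w. w \<in> W \<Longrightarrow> B *v w \<in> W"
    and comm: "A ** B = B ** A" and w: "w \<in> W" "w \<noteq> 0"
  shows "\<exists>v y z. v \<in> W \<and> v \<noteq> 0 \<and> A *v v = y *s v \<and> B *v v = z *s v"
proof -
  obtain u y where u: "u \<in> W" "u \<noteq> 0" "A *v u = y *s u"
    using ex_eigenvector_in_subspace[OF W invA w] by blast
  define E where "E = {v \<in> W. A *v v = y *s v}"
  have "vec.subspace E"
    unfolding vec.subspace_def E_def using W
    by (auto simp: vec.subspace_0 vec.subspace_add vec.subspace_scale vec.add vec.scale
        vec.scale_right_distrib vector_smult_assoc mult.commute)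
  moreover have "B *v v \<in> E" if "v \<in> E" for v
    using that invB comm by (auto simp: E_def matrix_vector_mul_assoc simp flip: vec.scale)
      (metis matrix_vector_mul_assoc vec.scale)
  moreover have "u \<in> E" using u by (simp add: E_def)
  ultimately obtain v z where "v \<in> E" "v \<noteq> 0" "B *v v = z *s v"
    using ex_eigenvector_in_subspace[of E B u] u(2) by blast
  then show ?thesis unfolding E_def by blast
qed

section \<open>The principal matrix logarithm\<close>

text \<open>
  The exponents \<open>k n\<close> are arbitrary so that the lemma covers both the series of the logarithm, which
  starts at degree \<open>1\<close>, and that of \<open>exp_quotient\<close>.
\<close>
lemma series_on_eigenvector:
  fixes X :: "'n::finite cmat"
  assumes "summable (\<lambda>n. c n *\<^sub>R X ^ k n)" "summable (\<lambda>n. c n *\<^sub>R z ^ k n)"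
    and eig: "mat_of X *v v = z *s v"
  shows "mat_of (\<Sum>n. c n *\<^sub>R X ^ k n) *v v = (\<Sum>n. c n *\<^sub>R z ^ k n) *s v"
proof -
  have pow: "mat_of (X ^ n) *v v = z ^ n *s v" for n
    by (induction n)
      (simp_all add: mat_of_simps eig vec.scale vector_smult_assoc mult.commute flip: matrix_vector_mul_assoc)
  have lin1: "bounded_linear (\<lambda>T::'n cmat. mat_of T *v v)"
  proof (rule bounded_linear_intro)
    show "norm (mat_of T *v v) \<le> norm T * norm v" for T :: "'n cmat"
      using norm_matrix_vector_le[of "mat_of T" v] by (simp add: mat_of_simps)
  qed (simp_all add: mat_of_simps matrix_vector_mult_add_rdistrib scaleR_matrix_vector)
  have scale: "(r *\<^sub>R w) *s v = r *\<^sub>R (w *s v)" for r :: real and w :: complex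
    by (simp add: vec_eq_iff)
  have lin2: "bounded_linear (\<lambda>x::complex. x *s v)"
  proof (rule bounded_linear_intro)
    show "norm (x *s v) \<le> norm x * norm v" for x by (simp add: norm_vec_smult)
  qed (simp_all add: vec_eq_iff algebra_simps)
  have "mat_of (\<Sum>n. c n *\<^sub>R X ^ k n) *v v = (\<Sum>n. mat_of (c n *\<^sub>R X ^ k n) *v v)"
    by (rule bounded_linear.suminf[OF lin1 assms(1)])
  also have "\<dots> = (\<Sum>n. (c n *\<^sub>R z ^ k n) *s v)"
    by (simp add: mat_of_simps scaleR_matrix_vector pow scale)
  also have "\<dots> = (\<Sum>n. c n *\<^sub>R z ^ k n) *s v"
    by (rule bounded_linear.suminf[OF lin2 assms(2), symmetric])
  finally show ?thesis .
qed

lemma eigenvalue_le_opnorm: "A *v v = z *s v \<Longrightarrow> v \<noteq> 0 \<Longrightarrow> cmod z \<le> opnorm A"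
  using norm_matrix_vector_le[of A v] by (simp add: norm_vec_smult)

lemma log1p_series_eq_Ln:
  assumes "cmod z < 1"
  shows "log1p_series z = Ln (1 + z)"
proof -
  have "(\<lambda>n. (-1) ^ Suc n / of_nat n * z ^ n) sums Ln (1 + z)" using Ln_series[OF assms] .
  then have "(\<lambda>n. (-1) ^ Suc (Suc n) / of_nat (Suc n) * z ^ Suc n) sums Ln (1 + z)"
    using sums_Suc_iff[of "\<lambda>n. (-1) ^ Suc n / of_nat n * z ^ n" "Ln (1 + z)"] by simp
  moreover have "(\<lambda>n. (-1) ^ Suc (Suc n) / of_nat (Suc n) * z ^ Suc n)
      = (\<lambda>n. ((-1) ^ n / (real n + 1)) *\<^sub>R z ^ Suc n)"
    by (auto simp: scaleR_conv_of_real fun_eq_iff add.commute)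
  ultimately have "(\<lambda>n. ((-1) ^ n / (real n + 1)) *\<^sub>R z ^ Suc n) sums Ln (1 + z)"
    by (simp only:)
  then show ?thesis unfolding log1p_series_def by (rule sums_unique[symmetric])
qed

text \<open>
  In an eigenspace of \<open>L = log (1 + X)\<close> there is an eigenvector of \<open>X\<close>, say for \<open>\<mu>\<close>, as \<open>X\<close> commutes with
  \<open>L\<close>. So the eigenvalues of \<open>L\<close> are values \<open>Ln (1 + \<mu>)\<close> with \<open>\<bar>\<mu>\<bar> < 1\<close>, and \<open>1 + \<mu>\<close> lies in
  the right half plane.
\<close>
lemma log1p_series_eigenvalue:
  fixes X :: "'n::finite cmat"
  assumes "norm X < 1" "is_eigenvalue (mat_of (log1p_series X)) z"
  shows "- pi < Im z" "Im z < pi"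
proof -
  define L where "L = log1p_series X"
  obtain w where w: "w \<noteq> 0" "mat_of L *v w = z *s w"
    using assms(2) by (auto simp: is_eigenvalue_def L_def)
  have "L * X = X * L" unfolding L_def by (rule log1p_series_commute[OF assms(1) refl])
  then have "mat_of L ** mat_of X = mat_of X ** mat_of L"
    by (metis mat_of_simps(6))
  then obtain v \<mu> where v: "v \<noteq> 0" "mat_of L *v v = z *s v" "mat_of X *v v = \<mu> *s v"
  proof -
    define E where "E = {v. mat_of L *v v = z *s v}"
    have "vec.subspace E"
      unfolding vec.subspace_def E_def
      by (auto simp: vec.add vec.scale vec.scale_right_distrib vector_smult_assoc mult.commute)
    moreover have "mat_of X *v v \<in> E" if "v \<in> E" for v
      using that \<open>mat_of L ** mat_of X = _\<close>
      by (auto simp: E_def) (metis matrix_vector_mul_assoc vec.scale)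
    moreover have "w \<in> E" using w by (simp add: E_def)
    ultimately obtain v \<mu> where "v \<in> E" "v \<noteq> 0" "mat_of X *v v = \<mu> *s v"
      using ex_eigenvector_in_subspace[of E "mat_of X" w] w(1) by blast
    then show ?thesis using that by (simp add: E_def)
  qed
  have "cmod \<mu> < 1"
    using eigenvalue_le_opnorm[OF v(3,1)] assms(1) by (simp add: mat_of_simps)
  have "mat_of L *v v = log1p_series \<mu> *s v"
    unfolding L_def log1p_series_def
    by (intro series_on_eigenvector summable_log1p_series v assms \<open>cmod \<mu> < 1\<close>)
  then have z: "z = Ln (1 + \<mu>)"
    using v log1p_series_eq_Ln[OF \<open>cmod \<mu> < 1\<close>] by simp
  have "1 + \<mu> \<noteq> 0"
    using \<open>cmod \<mu> < 1\<close> by (metis add_eq_0_iff norm_minus_cancel norm_one order_less_irrefl)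
  have "0 < Re (1 + \<mu>)" using abs_Re_le_cmod[of \<mu>] \<open>cmod \<mu> < 1\<close> by simp
  then have "\<bar>Im z\<bar> < pi / 2" unfolding z using Re_Ln_pos_lt[OF \<open>1 + \<mu> \<noteq> 0\<close>] by simp
  then show "- pi < Im z" "Im z < pi" using pi_gt_zero by linarith+
qed

text \<open>
  \<open>Y\<close> commutes with \<open>exp Y = 1 + X\<close>, hence with \<open>L = log (1 + X)\<close>, and \<open>Z = Y - L\<close> satisfies \<open>exp Z = 1\<close>,
  that is, \<open>\<phi>(Z) Z = 0\<close> for \<open>\<phi>(z) = (exp z - 1) / z\<close>. If \<open>Z \<noteq> 0\<close>, then \<open>Y\<close> and \<open>Z\<close> have a common
  eigenvector in the range of \<open>Z\<close>, where \<open>\<phi>(Z)\<close> vanishes; the eigenvalue \<open>\<zeta>\<close> of \<open>Z\<close> is a zero of \<open>\<phi>\<close>, so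
  a nonzero multiple of \<open>2 \<pi> i\<close>. But \<open>\<zeta>\<close> is a difference of eigenvalues of \<open>Y\<close> and \<open>L\<close>,
  and both lie in the strip of width \<open>2 \<pi>\<close>. The value \<open>\<phi>(0) = 1\<close> excludes
  \<open>\<zeta> = 0\<close>, so the argument covers nilpotent \<open>Z\<close> as well.
\<close>
lemma principal_log_unique:
  fixes X Y :: "'n::finite cmat"
  assumes "norm X < 1" "exp Y = 1 + X"
    and strip: "\<And>z. is_eigenvalue (mat_of Y) z \<Longrightarrow> - pi < Im z \<and> Im z < pi"
  shows "Y = log1p_series X"
proof (rule ccontr)
  assume "Y \<noteq> log1p_series X"
  define L where "L = log1p_series X"
  define Z where "Z = Y - L"
  have "Y * X = X * Y"
    using exp_times_arg_commute[of Y] unfolding assms(2) by (simp add: algebra_simps)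
  then have LY: "L * Y = Y * L" unfolding L_def by (intro log1p_series_commute assms) simp
  have YZ: "Y * Z = Z * Y" unfolding Z_def by (simp add: LY algebra_simps)
  have "exp Z = exp Y * exp (- L)"
    unfolding Z_def using exp_add_commuting[of Y "- L"] LY by simp
  also have "\<dots> = exp L * exp (- L)"
    using assms exp_log1p_series[OF assms(1)] by (simp add: L_def)
  finally have "exp Z = 1" by (simp add: exp_minus_inverse)
  then have annih: "exp_quotient Z * Z = 0" by (simp add: exp_quotient_mult)
  have "Z \<noteq> 0" using \<open>Y \<noteq> _\<close> by (simp add: Z_def L_def)
  then obtain u0 where u0: "mat_of Z *v u0 \<noteq> 0"
    by (metis mat_of_inject mat_of_simps(1) matrix_eq matrix_vector_mult_0)
  define W where "W = range ((*v) (mat_of Z))"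
  have W: "vec.subspace W"
    unfolding W_def by (intro vec.subspace_image vec.subspace_UNIV)
  have comm: "mat_of Y ** mat_of Z = mat_of Z ** mat_of Y"
    using YZ by (metis mat_of_simps(6))
  have invY: "mat_of Y *v v \<in> W" if "v \<in> W" for v
    using that comm by (auto simp: W_def matrix_vector_mul_assoc) (metis matrix_vector_mul_assoc rangeI)
  have invZ: "mat_of Z *v v \<in> W" if "v \<in> W" for v by (simp add: W_def)
  obtain v y \<zeta> where v: "v \<in> W" "v \<noteq> 0" "mat_of Y *v v = y *s v" "mat_of Z *v v = \<zeta> *s v"
    using ex_common_eigenvector_in_subspace[OF W invY invZ comm, of "mat_of Z *v u0"] u0
    unfolding W_def by blast
  obtain u where u: "v = mat_of Z *v u" using v(1) by (auto simp: W_def)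
  have "exp_quotient \<zeta> *s v = mat_of (exp_quotient Z) *v v"
    unfolding exp_quotient_def
    by (intro series_on_eigenvector[symmetric] summable_exp_quotient v)
  also have "\<dots> = mat_of (exp_quotient Z * Z) *v u"
    by (simp add: u mat_of_simps matrix_vector_mul_assoc)
  finally have q0: "exp_quotient \<zeta> = 0" using annih v(2) by (simp add: mat_of_simps)
  then have "\<zeta> \<noteq> 0" using exp_quotient_0[where 'a = complex] by auto
  have "exp \<zeta> = 1" using exp_quotient_mult[of \<zeta>] q0 by simp
  then obtain n :: int where n: "Re \<zeta> = 0" "Im \<zeta> = of_int (2 * n) * pi"
    by (auto simp: exp_eq_1)
  then have "n \<noteq> 0" using \<open>\<zeta> \<noteq> 0\<close> by (auto simp: complex_eq_iff)
  then have "1 \<le> \<bar>real_of_int n\<bar>" by linarith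
  then have large: "2 * pi \<le> \<bar>Im \<zeta>\<bar>" by (simp add: n(2) abs_mult)
  have "mat_of L *v v = (y - \<zeta>) *s v"
  proof -
    have "mat_of L = mat_of Y - mat_of Z" by (simp add: Z_def mat_of_simps)
    then show ?thesis by (simp add: matrix_vector_mult_diff_rdistrib v vec.scale_left_diff_distrib)
  qed
  then have "is_eigenvalue (mat_of L) (y - \<zeta>)" using v(2) by (auto simp: is_eigenvalue_def)
  from log1p_series_eigenvalue[OF assms(1) this[unfolded L_def]]
  have "- pi < Im y - Im \<zeta>" "Im y - Im \<zeta> < pi" by simp_all
  moreover have "- pi < Im y \<and> Im y < pi"
    using v by (intro strip) (auto simp: is_eigenvalue_def)
  ultimately show False using large by linarith
qed

theorem matrix_log_eq_series:
  assumes "opnorm (A - mat 1) < 1"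
  shows "matrix_log A = mat_of (log1p_series (of_mat (A - mat 1)))"
proof -
  define X where "X = of_mat (A - mat 1)"
  have X: "norm X < 1"
    using assms by (metis X_def mat_of_simps(8) of_mat_inverse UNIV_I)
  have A: "A = mat_of (1 + X)"
    by (simp add: X_def mat_of_simps of_mat_inverse)
  show ?thesis
    unfolding matrix_log_def X_def[symmetric]
  proof (rule the_equality, intro conjI allI impI)
    show "matrix_exp (mat_of (log1p_series X)) = A"
      by (simp add: A exp_log1p_series[OF X] flip: mat_of_exp)
    show "- pi < Im z" "Im z < pi" if "is_eigenvalue (mat_of (log1p_series X)) z" for z
      using log1p_series_eigenvalue[OF X that] by auto
  next
    fix Y assume Y: "matrix_exp Y = A \<and> (\<forall>z. is_eigenvalue Y z \<longrightarrow> - pi < Im z \<and> Im z < pi)"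
    have inv: "mat_of (of_mat Y) = Y" by (simp add: of_mat_inverse)
    have "mat_of (exp (of_mat Y)) = mat_of (1 + X)"
      using Y by (simp add: mat_of_exp inv A)
    then have "exp (of_mat Y) = 1 + X" by (simp add: mat_of_inject)
    then have "of_mat Y = log1p_series X"
      using Y by (intro principal_log_unique X) (simp_all add: inv)
    then show "Y = mat_of (log1p_series X)" using inv by simp
  qed
qed

section \<open>Orthogonality of the Legendre polynomials\<close>

lemma integrable_poly: "poly p integrable_on {a..b}" for p :: "real poly"
  by (intro integrable_continuous_real continuous_intros)

lemma integral_poly_add:
  "integral {a..b} (poly (p + q)) = integral {a..b} (poly p) + integral {a..b} (poly q)"
  for p q :: "real poly"
proof -
  have "poly (p + q) = (\<lambda>x. poly p x + poly q x)" by auto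
  then show ?thesis by (simp add: integral_add integrable_poly)
qed

lemma integral_poly_smult:
  "integral {a..b} (poly (smult c p)) = c * integral {a..b} (poly p)" for p :: "real poly"
proof -
  have "poly (smult c p) = (\<lambda>x. c * poly p x)" by auto
  then show ?thesis by simp
qed

lemma integral_poly_sum:
  "finite S \<Longrightarrow> integral {a..b} (poly (\<Sum>i\<in>S. f i)) = (\<Sum>i\<in>S. integral {a..b} (poly (f i)))"
  for f :: "'i \<Rightarrow> real poly"
proof -
  assume "finite S"
  moreover have "poly (\<Sum>i\<in>S. f i) = (\<lambda>x. \<Sum>i\<in>S. poly (f i) x)" by (auto simp: poly_sum)
  ultimately show ?thesis by (simp add: integral_sum integrable_poly)
qed

lemma integral_poly_pderiv:
  "a \<le> b \<Longrightarrow> integral {a..b} (poly (pderiv p)) = poly p b - poly p a" for p :: "real poly"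
  by (intro integral_unique fundamental_theorem_of_calculus)
    (auto intro!: poly_DERIV DERIV_subset[of _ _ _ UNIV] simp flip: has_real_derivative_iff_has_vector_derivative)

lemma integral_poly_monom_01: "integral {0..1} (poly (monom 1 n)) = 1 / (real n + 1)"
proof -
  have "monom 1 n = pderiv (monom (1 / (real n + 1)) (Suc n))"
    by (simp add: pderiv_monom)
  then show ?thesis
    using integral_poly_pderiv[of 0 1 "monom (1 / (real n + 1)) (Suc n)"]
    by (simp add: poly_monom)
qed

lemma poly_eq_0_if_vanishes_on_interval:
  fixes p :: "real poly"
  assumes "a < b" "\<And>x. a < x \<Longrightarrow> x < b \<Longrightarrow> poly p x = 0"
  shows "p = 0"
proof (rule ccontr)
  assume "p \<noteq> 0"
  then have "finite {x. poly p x = 0}" by (rule poly_roots_finite)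
  moreover have "{a<..<b} \<subseteq> {x. poly p x = 0}" using assms by auto
  ultimately have "finite {a<..<b}" by (rule finite_subset[rotated])
  then show False using infinite_Ioo[OF \<open>a < b\<close>] by simp
qed

lemma integral_poly_pos:
  fixes p :: "real poly"
  assumes "a < b" "p \<noteq> 0" "\<And>x. a < x \<Longrightarrow> x < b \<Longrightarrow> 0 \<le> poly p x"
  shows "0 < integral {a..b} (poly p)"
proof -
  have nonneg: "0 \<le> poly p x" if "x \<in> {a..b}" for x
  proof -
    have "closure {a<..<b} \<subseteq> {x. 0 \<le> poly p x}"
      by (rule closure_minimal) (auto intro!: closed_Collect_le continuous_intros assms)
    then show ?thesis using that closure_greaterThanLessThan[OF \<open>a < b\<close>] by auto
  qed
  have "0 \<le> integral {a..b} (poly p)"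
    by (intro integral_nonneg integrable_poly nonneg)
  moreover have "integral {a..b} (poly p) \<noteq> 0"
  proof
    assume "integral {a..b} (poly p) = 0"
    then have "(poly p has_integral 0) {a..b}"
      using integrable_integral[OF integrable_poly] by metis
    then have "poly p x = 0" if "x \<in> {a..b}" for x
      using has_integral_0_cbox_imp_0[of a b "poly p" x] nonneg that \<open>a < b\<close>
      by (auto simp: cbox_interval continuous_on_poly)
    then show False
      using poly_eq_0_if_vanishes_on_interval[OF \<open>a < b\<close>, of p] \<open>p \<noteq> 0\<close> by auto
  qed
  ultimately show ?thesis by simp
qed

lemma integral_poly_half_shift:
  "integral {-1..1} (poly (p \<circ>\<^sub>p [:1/2, 1/2:])) = 2 * integral {0..1} (poly p)" for p :: "real poly"
proof -
  have "(poly p has_integral integral {0..1} (poly p)) (cbox 0 1)"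
    using integrable_integral[OF integrable_poly] by (simp add: cbox_interval)
  from has_integral_affinity[OF this, of "1/2" "1/2"]
  have "((\<lambda>x. poly p (1/2 * x + 1/2)) has_integral 2 * integral {0..1} (poly p))
      ((\<lambda>x. 2 * x - 1) ` {0..1})"
    by (simp add: cbox_interval algebra_simps)
  moreover have "(\<lambda>x. 2 * x - 1) ` {0..1} = {-1..(1::real)}"
    using image_affinity_atLeastAtMost[of 2 "-1" 0 "1::real"] by simp
  moreover have "poly (p \<circ>\<^sub>p [:1/2, 1/2:]) = (\<lambda>x. poly p (1/2 * x + 1/2))"
    by (auto simp: poly_pcompose algebra_simps)
  ultimately show ?thesis
    by (intro integral_unique) metis
qed

lemma power_dvd_pderiv: "p ^ Suc k dvd f \<Longrightarrow> p ^ k dvd pderiv f" for p f :: "real poly"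
proof -
  assume "p ^ Suc k dvd f"
  then obtain g where "f = p ^ Suc k * g" by (elim dvdE)
  then show "p ^ k dvd pderiv f"
    unfolding pderiv_mult pderiv_power_Suc \<open>f = _\<close>
    by (intro dvd_add dvd_mult dvd_mult2 dvd_smult) (auto intro: le_imp_power_dvd)
qed

lemma power_dvd_higher_pderiv:
  "p ^ (n - i) dvd (pderiv ^^ i) (p ^ n * g)" if "i \<le> n" for p g :: "real poly"
  using that
proof (induction i)
  case (Suc i)
  then have "p ^ Suc (n - Suc i) dvd (pderiv ^^ i) (p ^ n * g)"
    by (simp add: Suc_diff_Suc del: power_Suc)
  then show ?case by (simp add: power_dvd_pderiv)
qed simp

text \<open>
  Integration by parts \<open>n\<close> times moves all derivatives to \<open>g\<close>, where they give \<open>0\<close>. The hypothesis on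
  the coefficients says \<open>deg g < n\<close> in a form that is true of \<open>g = 0\<close> also for \<open>n = 0\<close>.
\<close>
lemma integral_higher_pderiv_orthogonal:
  fixes w g :: "real poly"
  assumes "a \<le> b"
    and "\<And>i. i < n \<Longrightarrow> poly ((pderiv ^^ i) w) a = 0" "\<And>i. i < n \<Longrightarrow> poly ((pderiv ^^ i) w) b = 0"
    and "\<And>k. n \<le> k \<Longrightarrow> coeff g k = 0"
  shows "integral {a..b} (poly ((pderiv ^^ n) w * g)) = 0"
  using assms
proof (induction n arbitrary: g)
  case 0
  then have "g = 0" by (intro poly_eqI) simp
  then show ?case by simp
next
  case (Suc n)
  have "integral {a..b} (poly ((pderiv ^^ n) w * pderiv g)) = 0"
    using Suc.prems by (intro Suc.IH) (auto simp: coeff_pderiv)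
  moreover have "integral {a..b} (poly (pderiv ((pderiv ^^ n) w * g))) = 0"
    using Suc.prems by (simp add: integral_poly_pderiv)
  ultimately show ?case
    by (simp add: pderiv_mult integral_poly_add mult.commute del: poly_mult)
qed

lemma degree_higher_pderiv: "degree ((pderiv ^^ i) p) = degree p - i" for p :: "real poly"
  by (induction i) (auto simp: degree_pderiv)

lemma degree_legendre_poly: "degree (legendre_poly n) = n"
  by (simp add: legendre_poly_def degree_higher_pderiv degree_power_eq)

lemma legendre_poly_nonzero: "legendre_poly n \<noteq> 0"
proof (cases "n = 0")
  case True
  then show ?thesis by (simp add: legendre_poly_def)
next
  case False
  then show ?thesis using degree_legendre_poly[of n] by auto
qed

text \<open>
  \<open>(x\<^sup>2 - 1)\<^sup>n\<close> has zeros of order \<open>n\<close> at \<open>1\<close> and \<open>-1\<close>, so its derivatives of order less than \<open>n\<close>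
  vanish there, and no boundary terms occur in the integrations by parts.
\<close>
lemma legendre_poly_orthogonal:
  assumes "\<And>k. n \<le> k \<Longrightarrow> coeff g k = 0"
  shows "integral {-1..1} (poly (legendre_poly n * g)) = 0"
proof -
  have eq: "[:-1, 0, 1::real:] ^ n = [:-1, 1:] ^ n * [:1, 1:] ^ n"
    "[:-1, 0, 1:] ^ n = [:1, 1:] ^ n * [:-1, 1::real:] ^ n"
    unfolding power_mult_distrib[symmetric] by simp_all
  have "poly ((pderiv ^^ i) ([:-1, 0, 1:] ^ n)) 1 = (0::real)" if "i < n" for i
  proof -
    have "[:-1, 1:] dvd [:-1, 1::real:] ^ (n - i)" using that by (intro dvd_power) simp
    also have "\<dots> dvd (pderiv ^^ i) ([:-1, 0, 1:] ^ n)"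
      unfolding eq(1) using that by (intro power_dvd_higher_pderiv) simp
    finally show ?thesis by (simp add: poly_eq_0_iff_dvd)
  qed
  moreover have "poly ((pderiv ^^ i) ([:-1, 0, 1:] ^ n)) (-1) = (0::real)" if "i < n" for i
  proof -
    have "[:1, 1:] dvd [:1, 1::real:] ^ (n - i)" using that by (intro dvd_power) simp
    also have "\<dots> dvd (pderiv ^^ i) ([:-1, 0, 1:] ^ n)"
      unfolding eq(2) using that by (intro power_dvd_higher_pderiv) simp
    finally show ?thesis by (simp add: poly_eq_0_iff_dvd)
  qed
  ultimately have "integral {-1..1} (poly ((pderiv ^^ n) ([:-1, 0, 1:] ^ n) * g)) = 0"
    using assms by (intro integral_higher_pderiv_orthogonal) auto
  then show ?thesis
    by (simp add: legendre_poly_def integral_poly_smult)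
qed

section \<open>Gauss-Legendre quadrature\<close>

definition node_poly :: "('m::finite \<Rightarrow> real) \<Rightarrow> real poly" where
  "node_poly t = (\<Prod>i\<in>UNIV. [:- t i, 1:])"

lemma degree_node_poly: "degree (node_poly (t :: 'm::finite \<Rightarrow> real)) = CARD('m)"
  unfolding node_poly_def by (subst degree_prod_eq_sum_degree) auto

lemma node_poly_nonzero: "node_poly t \<noteq> 0"
  by (simp add: node_poly_def)

lemma poly_node_poly: "poly (node_poly t) (t i) = 0"
  unfolding node_poly_def poly_prod by (intro prod_zero) auto

lemma prod_linear_dvd:
  fixes p :: "real poly"
  assumes "finite S" "inj_on t S" "\<And>i. i \<in> S \<Longrightarrow> poly p (t i) = 0"
  shows "(\<Prod>i\<in>S. [:- t i, 1:]) dvd p"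
  using assms
proof (induction S rule: finite_induct)
  case (insert j S)
  then have "(\<Prod>i\<in>S. [:- t i, 1:]) dvd p" by auto
  then obtain r where r: "p = (\<Prod>i\<in>S. [:- t i, 1:]) * r" by (elim dvdE)
  have "poly (\<Prod>i\<in>S. [:- t i, 1:]) (t j) \<noteq> 0"
    using insert by (auto simp: poly_prod inj_on_def)
  moreover have "poly p (t j) = 0" using insert by simp
  ultimately have "poly r (t j) = 0" using r by simp
  then have "[:- t j, 1:] dvd r" by (simp add: poly_eq_0_iff_dvd)
  then show ?case
    unfolding r prod.insert[OF insert.hyps] mult.commute[of "[:- t j, 1:]"]
    by (intro mult_dvd_mono) simp_all
qed simp

lemma node_poly_dvd: "inj t \<Longrightarrow> (\<And>i. poly p (t i) = 0) \<Longrightarrow> node_poly t dvd p"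
  unfolding node_poly_def by (rule prod_linear_dvd) auto

lemma poly_lagrange_basis:
  "inj t \<Longrightarrow> poly (lagrange_basis t j) (t i) = (if i = j then 1 else 0)"
  by (auto simp: lagrange_basis_def poly_prod inj_def intro!: prod.neutral prod_zero
      simp flip: diff_divide_distrib split: if_splits)

lemma degree_lagrange_basis: "degree (lagrange_basis (t :: 'm::finite \<Rightarrow> real) j) < CARD('m)"
proof -
  have "degree (lagrange_basis t j) \<le> (\<Sum>i\<in>UNIV - {j}. degree (smult (1 / (t j - t i)) [:- t i, 1:]))"
    unfolding lagrange_basis_def by (intro order.trans[OF degree_prod_sum_le]) (auto simp: o_def)
  also have "\<dots> \<le> (\<Sum>i\<in>UNIV - {j}. 1)"
    by (intro sum_mono order.trans[OF degree_smult_le]) simp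
  also have "\<dots> < CARD('m)" by (simp add: card_Diff_singleton)
  finally show ?thesis .
qed

lemma lagrange_interpolation:
  fixes t :: "'m::finite \<Rightarrow> real"
  assumes "inj t" "degree p < CARD('m)"
  shows "p = (\<Sum>j\<in>UNIV. smult (poly p (t j)) (lagrange_basis t j))"
proof -
  define r where "r = p - (\<Sum>j\<in>UNIV. smult (poly p (t j)) (lagrange_basis t j))"
  have "degree (\<Sum>j\<in>UNIV. smult (poly p (t j)) (lagrange_basis t j)) < CARD('m)"
    by (intro degree_sum_less zero_less_card_finite order.strict_trans1[OF degree_smult_le] degree_lagrange_basis)
  then have "degree r < CARD('m)"
    unfolding r_def using assms(2) by (intro degree_diff_less)
  moreover have "node_poly t dvd r"
    using \<open>inj t\<close> by (intro node_poly_dvd)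
      (auto simp: r_def poly_sum poly_lagrange_basis if_distrib cong: if_cong)
  ultimately have "r = 0"
    using dvd_imp_degree_le[of "node_poly t" r] by (auto simp: degree_node_poly)
  then show ?thesis by (simp add: r_def)
qed

lemma legendre_poly_eq_node_poly:
  fixes t :: "'m::finite \<Rightarrow> real"
  assumes "gauss_legendre t s"
  obtains c where "c \<noteq> 0" "legendre_poly CARD('m) = smult c (node_poly t)"
proof -
  have "node_poly t dvd legendre_poly CARD('m)"
    using assms by (intro node_poly_dvd) (auto simp: gauss_legendre_def)
  then obtain r where r: "legendre_poly CARD('m) = node_poly t * r" by (elim dvdE)
  then have "r \<noteq> 0" using legendre_poly_nonzero by force
  then have "degree r = 0"
    using arg_cong[OF r, of degree]
    by (simp add: degree_legendre_poly degree_mult_eq node_poly_nonzero degree_node_poly)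
  then obtain c where "r = [:c:]" by (elim degree_eq_zeroE)
  then show ?thesis using that[of c] r \<open>r \<noteq> 0\<close> by (simp add: mult.commute)
qed

lemma node_poly_orthogonal:
  fixes t :: "'m::finite \<Rightarrow> real"
  assumes "gauss_legendre t s" "g = 0 \<or> degree g < CARD('m)"
  shows "integral {-1..1} (poly (node_poly t * g)) = 0"
proof -
  obtain c where c: "c \<noteq> 0" "legendre_poly CARD('m) = smult c (node_poly t)"
    using legendre_poly_eq_node_poly[OF assms(1)] .
  have "integral {-1..1} (poly (legendre_poly CARD('m) * g)) = 0"
    using assms(2) by (intro legendre_poly_orthogonal) (auto intro: coeff_eq_0)
  then show ?thesis using c by (simp add: integral_poly_smult)
qed

text \<open>
  Gauss's argument: divide \<open>p\<close> by the node polynomial. Quotient and remainder have degree below \<open>M\<close>;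
  the multiple of the node polynomial has integral \<open>0\<close> by orthogonality and vanishes at the nodes, and the
  rule integrates the remainder exactly because it is interpolatory.
\<close>
lemma gauss_legendre_exact_symmetric_interval:
  fixes t :: "'m::finite \<Rightarrow> real"
  assumes gl: "gauss_legendre t s" and deg: "degree p < 2 * CARD('m)"
  shows "integral {-1..1} (poly p) = (\<Sum>j\<in>UNIV. s j * poly p (t j))"
proof -
  define U where "U = p div node_poly t"
  define V where "V = p mod node_poly t"
  have p: "p = node_poly t * U + V" by (simp add: U_def V_def)
  have V: "degree V < CARD('m)"
    using degree_mod_less'[OF node_poly_nonzero, of p t]
    by (cases "V = 0") (auto simp: V_def degree_node_poly)
  have U: "U = 0 \<or> degree U < CARD('m)"
  proof (cases "U = 0")
    case False
    then have "degree (node_poly t * U) = CARD('m) + degree U"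
      by (simp add: degree_mult_eq node_poly_nonzero degree_node_poly)
    then have "degree p = CARD('m) + degree U"
      unfolding p using V by (subst degree_add_eq_left) auto
    then show ?thesis using deg by simp
  qed simp
  have inj: "inj t" using gl by (simp add: gauss_legendre_def)
  have "integral {-1..1} (poly p) = integral {-1..1} (poly V)"
    unfolding p integral_poly_add node_poly_orthogonal[OF gl U] by simp
  also have "\<dots> = integral {-1..1} (poly (\<Sum>j\<in>UNIV. smult (poly V (t j)) (lagrange_basis t j)))"
    using lagrange_interpolation[OF inj V] by simp
  also have "\<dots> = (\<Sum>j\<in>UNIV. s j * poly V (t j))"
    using gl by (simp add: integral_poly_sum integral_poly_smult gauss_legendre_def mult.commute del: poly_sum)
  also have "\<dots> = (\<Sum>j\<in>UNIV. s j * poly p (t j))"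
    unfolding p by (simp add: poly_node_poly)
  finally show ?thesis .
qed

text \<open>
  Let \<open>q = (x - t\<^sub>k) g\<close> be the node polynomial. Orthogonality gives \<open>\<integral> (x - t\<^sub>k) g\<^sup>2 = \<integral> q g = 0\<close>, which is
  impossible if \<open>x - t\<^sub>k\<close> has constant sign on \<open>(-1, 1)\<close>.
\<close>
lemma gauss_legendre_nodes:
  fixes t :: "'m::finite \<Rightarrow> real"
  assumes gl: "gauss_legendre t s"
  shows "-1 < t k" "t k < 1"
proof -
  have "[:- t k, 1:] dvd node_poly t"
    using poly_node_poly by (simp add: poly_eq_0_iff_dvd)
  then obtain g where g: "node_poly t = [:- t k, 1:] * g" by (elim dvdE)
  then have "g \<noteq> 0" using node_poly_nonzero by force
  have "degree g < CARD('m)"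
    using arg_cong[OF g, of degree] \<open>g \<noteq> 0\<close> by (simp add: degree_node_poly degree_mult_eq del: mult_pCons_left)
  then have I: "integral {-1..1} (poly (node_poly t * g)) = 0"
    by (intro node_poly_orthogonal[OF gl]) simp
  have val: "poly (node_poly t * g) x = (x - t k) * (poly g x)\<^sup>2" for x
    unfolding g by (simp add: power2_eq_square algebra_simps)
  have ne: "node_poly t * g \<noteq> 0" using \<open>g \<noteq> 0\<close> node_poly_nonzero by auto
  show "-1 < t k"
  proof (rule ccontr)
    assume "\<not> -1 < t k"
    then have "0 < integral {-1..1} (poly (node_poly t * g))"
      using ne by (intro integral_poly_pos) (auto simp: val simp del: poly_mult)
    then show False using I by simp
  qed
  show "t k < 1"
  proof (rule ccontr)
    assume "\<not> t k < 1"
    then have "0 < integral {-1..1} (poly (- (node_poly t * g)))"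
      using ne by (intro integral_poly_pos)
        (auto simp: val mult_nonpos_nonneg simp del: poly_mult mult_minus_left mult_minus_right minus_mult_left)
    then show False using I integral_poly_smult[of "-1" 1 "-1" "node_poly t * g"] by simp
  qed
qed

text \<open>
  The properties of the rule on \<open>[0, 1]\<close> from which everything else follows: exactness controls the
  order and, with the nodes being nonnegative, the sign of the error on monomials; with the nodes being
  nonzero, every factor \<open>1 + \<tau>\<^sub>j x\<close> of the Pade denominator has a root.
\<close>
locale gauss_unit =
  fixes \<tau> \<omega> :: "'m::finite \<Rightarrow> real"
  assumes inj_nodes: "inj \<tau>"
    and nodes_pos: "0 < \<tau> j" and nodes_less_1: "\<tau> j < 1"
    and exact: "degree p < 2 * CARD('m) \<Longrightarrow> integral {0..1} (poly p) = (\<Sum>j\<in>UNIV. \<omega> j * poly p (\<tau> j))"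

lemma gauss_legendre_imp_gauss_unit:
  fixes t s \<tau> \<omega> :: "'m::finite \<Rightarrow> real"
  assumes gl: "gauss_legendre t s"
    and \<tau>: "\<And>j. \<tau> j = 1/2 * t j + 1/2" and \<omega>: "\<And>j. \<omega> j = 1/2 * s j"
  shows "gauss_unit \<tau> \<omega>"
proof
  show "inj \<tau>" using gl by (auto simp: gauss_legendre_def inj_def \<tau>)
  show "0 < \<tau> j" "\<tau> j < 1" for j using gauss_legendre_nodes[OF gl, of j] by (auto simp: \<tau>)
  fix p :: "real poly" assume "degree p < 2 * CARD('m)"
  then have "degree (p \<circ>\<^sub>p [:1/2, 1/2:]) < 2 * CARD('m)" by (simp add: degree_pcompose)
  from gauss_legendre_exact_symmetric_interval[OF gl this]
  show "integral {0..1} (poly p) = (\<Sum>j\<in>UNIV. \<omega> j * poly p (\<tau> j))"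
    unfolding integral_poly_half_shift
    by (simp add: poly_pcompose \<tau> \<omega> algebra_simps flip: sum_divide_distrib)
qed

section \<open>The sign of the quadrature error on monomials\<close>

text \<open>
  For a polynomial \<open>f\<close> the error of Gauss quadrature is the integral of \<open>q\<^sup>2 S\<close>, where \<open>q\<close> is the node
  polynomial and \<open>S\<close> is the quotient of \<open>f\<close> by \<open>q\<^sup>2\<close>. For a monomial \<open>f\<close> and nonnegative nodes, the
  coefficients of \<open>S\<close> are nonnegative; this replaces the usual remainder formula with a derivative of
  \<open>f\<close> at an intermediate point.
\<close>
definition nonneg_coeffs :: "real poly \<Rightarrow> bool" where
  "nonneg_coeffs p \<longleftrightarrow> (\<forall>k. 0 \<le> coeff p k)"

lemma nonneg_coeffs_pCons [simp]: "nonneg_coeffs (pCons c p) \<longleftrightarrow> 0 \<le> c \<and> nonneg_coeffs p"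
  unfolding nonneg_coeffs_def by (auto simp: coeff_pCons split: nat.splits)

lemma nonneg_coeffs_0 [simp]: "nonneg_coeffs 0"
  by (simp add: nonneg_coeffs_def)

lemma nonneg_coeffs_poly_nonneg: "nonneg_coeffs p \<Longrightarrow> 0 \<le> x \<Longrightarrow> 0 \<le> poly p x"
  unfolding nonneg_coeffs_def poly_altdef by (intro sum_nonneg) auto

text \<open>
  Horner's scheme at \<open>a \<ge> 0\<close> only adds and multiplies nonnegative numbers.
\<close>
lemma nonneg_coeffs_div_linear:
  assumes "nonneg_coeffs p" "0 \<le> a"
  shows "\<exists>S r. p = [:- a, 1:] * S + [:r:] \<and> nonneg_coeffs S \<and> 0 \<le> r"
  using assms(1)
proof (induction p)
  case 0
  show ?case by (intro exI[of _ 0]) simp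
next
  case (pCons c p)
  then obtain S r where "p = [:- a, 1:] * S + [:r:]" "nonneg_coeffs S" "0 \<le> r" by auto
  then show ?case
    using pCons.prems \<open>0 \<le> a\<close>
    by (intro exI[of _ "pCons r S"] exI[of _ "r * a + c"]) (auto simp: algebra_simps)
qed

lemma nonneg_coeffs_div_prod_linear:
  assumes "finite S" "\<And>i. i \<in> S \<Longrightarrow> 0 \<le> \<tau> i" "nonneg_coeffs p"
  shows "\<exists>Q R. p = (\<Prod>i\<in>S. [:- \<tau> i, 1:]) * Q + R \<and> nonneg_coeffs Q \<and> (R = 0 \<or> degree R < card S)"
  using assms
proof (induction S arbitrary: p rule: finite_induct)
  case empty
  then show ?case by (intro exI[of _ p] exI[of _ 0]) simp
next
  case (insert j S)
  obtain P r where P: "p = [:- \<tau> j, 1:] * P + [:r:]" "nonneg_coeffs P"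
    using nonneg_coeffs_div_linear[of p "\<tau> j"] insert.prems by auto
  obtain Q R where Q: "P = (\<Prod>i\<in>S. [:- \<tau> i, 1:]) * Q + R" "nonneg_coeffs Q" "R = 0 \<or> degree R < card S"
    using insert.IH[of P] insert.prems P by auto
  have "degree ([:- \<tau> j, 1:] * R + [:r:]) < Suc (card S)"
  proof (cases "R = 0")
    case False
    then have "degree ([:- \<tau> j, 1:] * R) = Suc (degree R)"
      by (simp add: degree_mult_eq del: mult_pCons_left)
    then show ?thesis using Q(3) False
      by (intro degree_add_less) (auto simp del: mult_pCons_left)
  qed simp
  moreover have "p = (\<Prod>i\<in>insert j S. [:- \<tau> i, 1:]) * Q + ([:- \<tau> j, 1:] * R + [:r:])"
    unfolding P(1) Q(1) using insert.hyps
    by (simp add: algebra_simps del: mult_pCons_left mult_pCons_right)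
  ultimately show ?case
    using Q(2) insert.hyps by (metis card_insert_disjoint)
qed

context gauss_unit
begin

text \<open>
  The square of a Lagrange polynomial has degree at most \<open>2 M - 2\<close>, so the rule is exact for it, and the
  weight is the integral of this square.
\<close>
lemma weights_pos: "0 < \<omega> j"
proof -
  have val: "poly (lagrange_basis \<tau> j * lagrange_basis \<tau> j) (\<tau> i) = (if i = j then 1 else 0)" for i
    by (simp add: poly_lagrange_basis inj_nodes)
  have "degree (lagrange_basis \<tau> j * lagrange_basis \<tau> j) < 2 * CARD('m)"
    using degree_lagrange_basis[of \<tau> j] degree_mult_le[of "lagrange_basis \<tau> j" "lagrange_basis \<tau> j"]
    by linarith
  from exact[OF this] have "\<omega> j = integral {0..1} (poly (lagrange_basis \<tau> j * lagrange_basis \<tau> j))"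
    unfolding val by (simp add: if_distrib cong: if_cong)
  also have "\<dots> > 0"
  proof (rule integral_poly_pos)
    have "poly (lagrange_basis \<tau> j * lagrange_basis \<tau> j) (\<tau> j) \<noteq> 0" by (simp add: val del: poly_mult)
    then show "lagrange_basis \<tau> j * lagrange_basis \<tau> j \<noteq> 0" by (metis poly_0)
  qed auto
  finally show ?thesis .
qed

text \<open>
  The error \<open>\<integral> x\<^sup>n dx - \<Sum>\<^sub>j \<omega>\<^sub>j \<tau>\<^sub>j\<^sup>n\<close> of the rule on a monomial.
\<close>
definition moment_defect :: "nat \<Rightarrow> real" where
  "moment_defect n = 1 / (real n + 1) - (\<Sum>j\<in>UNIV. \<omega> j * \<tau> j ^ n)"

text \<open>
  Dividing twice by \<open>q\<close> gives \<open>x\<^sup>n = q\<^sup>2 Q' + V\<close> with \<open>deg V < 2 M\<close> and \<open>Q'\<close> with nonnegative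
  coefficients. The rule is exact on \<open>V\<close> and evaluates \<open>q\<^sup>2 Q'\<close> to \<open>0\<close>, so the error is
  \<open>\<integral> q\<^sup>2 Q' \<ge> 0\<close>.
\<close>
lemma moment_defect_nonneg: "0 \<le> moment_defect n"
proof -
  have mono: "nonneg_coeffs (monom 1 n)" by (simp add: nonneg_coeffs_def)
  obtain Q R where Q: "monom 1 n = node_poly \<tau> * Q + R" "nonneg_coeffs Q" "R = 0 \<or> degree R < CARD('m)"
    using nonneg_coeffs_div_prod_linear[of UNIV \<tau>, OF _ _ mono] nodes_pos
    unfolding node_poly_def by (auto simp: less_imp_le)
  obtain Q' R' where Q': "Q = node_poly \<tau> * Q' + R'" "nonneg_coeffs Q'" "R' = 0 \<or> degree R' < CARD('m)"
    using nonneg_coeffs_div_prod_linear[of UNIV \<tau>, OF _ _ Q(2)] nodes_pos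
    unfolding node_poly_def by (auto simp: less_imp_le)
  define V where "V = node_poly \<tau> * R' + R"
  have m: "monom 1 n = node_poly \<tau> * node_poly \<tau> * Q' + V"
    unfolding Q(1) Q'(1) V_def by (simp add: algebra_simps)
  have "degree (node_poly \<tau> * R') < 2 * CARD('m)"
    using Q'(3) degree_mult_le[of "node_poly \<tau>" R'] by (auto simp: degree_node_poly)
  then have "degree V < 2 * CARD('m)"
    unfolding V_def using Q(3) by (intro degree_add_less) auto
  from exact[OF this] have "integral {0..1} (poly V) = (\<Sum>j\<in>UNIV. \<omega> j * poly (monom 1 n) (\<tau> j))"
    unfolding m by (simp add: poly_node_poly)
  moreover have "integral {0..1} (poly (monom 1 n))
      = integral {0..1} (poly (node_poly \<tau> * node_poly \<tau> * Q')) + integral {0..1} (poly V)"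
    unfolding m by (rule integral_poly_add)
  moreover have "0 \<le> integral {0..1} (poly (node_poly \<tau> * node_poly \<tau> * Q'))"
    by (intro integral_nonneg integrable_poly)
      (simp add: nonneg_coeffs_poly_nonneg[OF Q'(2)])
  ultimately show ?thesis
    by (simp add: moment_defect_def integral_poly_monom_01 poly_monom)
qed

lemma moment_defect_eq_0: "n < 2 * CARD('m) \<Longrightarrow> moment_defect n = 0"
  using exact[of "monom 1 n"]
  by (simp add: moment_defect_def integral_poly_monom_01 poly_monom degree_monom_eq)

end

section \<open>The Pade approximant as a quadrature rule\<close>

text \<open>
  \<open>p q' - p' q\<close> has degree at most \<open>m + n\<close>, and as a power series it is a combination of the two error
  terms, which start at degree \<open>m + n + 1\<close>. So it vanishes, and two reduced fractions with the same value
  agree up to a constant factor, which the normalisation at \<open>0\<close> fixes.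
\<close>
lemma is_pade_unique:
  assumes "is_pade m n f (p, q)" "is_pade m n f (p', q')"
  shows "(p, q) = (p', q')"
proof -
  define u where "u = f * fps_of_poly q - fps_of_poly p"
  define v where "v = f * fps_of_poly q' - fps_of_poly p'"
  have u: "fps_nth u k = 0" and v: "fps_nth v k = 0" if "k \<le> m + n" for k
    using assms that by (auto simp: is_pade_def u_def v_def)
  have "fps_of_poly (p * q' - p' * q) = v * fps_of_poly q - u * fps_of_poly q'"
    by (simp add: u_def v_def fps_of_poly_mult fps_of_poly_diff algebra_simps)
  then have "coeff (p * q' - p' * q) k = fps_nth (v * fps_of_poly q - u * fps_of_poly q') k" for k
    by (metis fps_of_poly_nth)
  then have "coeff (p * q' - p' * q) k = 0" if "k \<le> m + n" for k
    using that u v by (simp add: fps_mult_nth)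
  moreover have "degree (p * q' - p' * q) \<le> m + n"
    using assms by (intro degree_diff_le order.trans[OF degree_mult_le]) (auto simp: is_pade_def intro: add_mono)
  ultimately have "p * q' - p' * q = 0"
    by (intro poly_eqI) (metis coeff_0 coeff_eq_0 le_less_linear order.strict_trans1)
  then have cross: "p * q' = p' * q" by simp
  have cop: "coprime p q" "coprime p' q'" and one: "poly q 0 = 1" "poly q' 0 = 1"
    using assms by (auto simp: is_pade_def)
  have "q dvd q' * p" "q' dvd q * p'"
    using cross by (metis dvd_triv_right mult.commute)+
  then have dvd: "q dvd q'" "q' dvd q"
    using cop by (metis coprime_commute coprime_dvd_mult_left_iff)+
  then obtain r where r: "q' = q * r" by (elim dvdE)
  have "q \<noteq> 0" "q' \<noteq> 0" using one by auto
  then have "degree q' = degree q"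
    using dvd by (simp add: dvd_imp_degree_le le_antisym)
  then have "degree r = 0"
    using r \<open>q' \<noteq> 0\<close> by (auto simp: degree_mult_eq)
  then obtain c where "r = [:c:]" by (elim degree_eq_zeroE)
  then have "q' = q" using r one by simp
  then show ?thesis using cross \<open>q \<noteq> 0\<close> by simp
qed

context gauss_unit
begin

text \<open>
  Numerator and denominator of \<open>\<Sum>\<^sub>j \<omega>\<^sub>j x / (1 + \<tau>\<^sub>j x)\<close>, the quadrature rule applied to
  \<open>log (1 + x) = \<integral> x / (1 + \<tau> x) d\<tau>\<close>.
\<close>
definition pade_denom :: "real poly" where
  "pade_denom = (\<Prod>j\<in>UNIV. [:1, \<tau> j:])"

definition pade_num :: "real poly" where
  "pade_num = (\<Sum>j\<in>UNIV. smult (\<omega> j) ([:0, 1:] * (\<Prod>i\<in>UNIV - {j}. [:1, \<tau> i:])))"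

lemma pade_denom_remove: "pade_denom = [:1, \<tau> j:] * (\<Prod>i\<in>UNIV - {j}. [:1, \<tau> i:])"
  unfolding pade_denom_def by (rule prod.remove) auto

lemma degree_pade_denom: "degree pade_denom \<le> CARD('m)"
proof -
  have "degree pade_denom \<le> (\<Sum>i\<in>UNIV. degree [:1, \<tau> i:])"
    unfolding pade_denom_def by (intro order.trans[OF degree_prod_sum_le]) (auto simp: o_def)
  also have "\<dots> \<le> (\<Sum>i\<in>(UNIV :: 'm set). 1)" by (intro sum_mono) simp
  finally show ?thesis by simp
qed

lemma degree_pade_num: "degree pade_num \<le> CARD('m)"
  unfolding pade_num_def
proof (intro degree_sum_le order.trans[OF degree_smult_le] finite)
  fix j :: 'm
  have "degree (\<Prod>i\<in>UNIV - {j}. [:1, \<tau> i:]) \<le> (\<Sum>i\<in>UNIV - {j}. degree [:1, \<tau> i:])"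
    by (intro order.trans[OF degree_prod_sum_le]) (auto simp: o_def)
  also have "\<dots> \<le> (\<Sum>i\<in>UNIV - {j}. 1)" by (intro sum_mono) simp
  finally have "degree (\<Prod>i\<in>UNIV - {j}. [:1, \<tau> i:]) \<le> CARD('m) - 1" by (simp add: card_Diff_singleton)
  then have "degree ([:0, 1:] * (\<Prod>i\<in>UNIV - {j}. [:1, \<tau> i:])) \<le> 1 + (CARD('m) - 1)"
    by (intro order.trans[OF degree_mult_le] add_mono) simp_all
  then show "degree ([:0, 1:] * (\<Prod>i\<in>UNIV - {j}. [:1, \<tau> i:])) \<le> CARD('m)"
    using zero_less_card_finite[where 'a = 'm] by simp
qed

lemma poly_pade_quotient:
  assumes "\<And>j. 1 + \<tau> j * x \<noteq> 0"
  shows "poly pade_num x / poly pade_denom x = (\<Sum>j\<in>UNIV. \<omega> j * (x / (1 + \<tau> j * x)))"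
proof -
  have "\<omega> j * (x / (1 + \<tau> j * x)) * poly pade_denom x
      = poly (smult (\<omega> j) ([:0, 1:] * (\<Prod>i\<in>UNIV - {j}. [:1, \<tau> i:]))) x" for j
  proof -
    define R where "R = poly (\<Prod>i\<in>UNIV - {j}. [:1, \<tau> i:]) x"
    have "poly pade_denom x = (1 + \<tau> j * x) * R"
      by (simp add: pade_denom_remove[of j] R_def algebra_simps)
    then show ?thesis using assms[of j] by (simp add: R_def[symmetric])
  qed
  then have "(\<Sum>j\<in>UNIV. \<omega> j * (x / (1 + \<tau> j * x))) * poly pade_denom x = poly pade_num x"
    by (simp add: sum_distrib_right pade_num_def poly_sum)
  moreover have "poly pade_denom x \<noteq> 0"
    using assms by (simp add: pade_denom_def poly_prod mult.commute)
  ultimately show ?thesis by (simp add: field_simps)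
qed

text \<open>
  At the pole \<open>-1 / \<tau>\<^sub>j\<close> only the \<open>j\<close>-th summand of the numerator survives; it is nonzero because the
  nodes are distinct and the weights positive.
\<close>
lemma coprime_pade: "coprime pade_num pade_denom"
  unfolding pade_denom_def
proof (rule prod_coprime_right)
  fix j :: 'm
  define z where "z = - 1 / \<tau> j"
  have pos: "\<tau> j \<noteq> 0" using nodes_pos[of j] by simp
  have z: "1 + \<tau> j * z = 0" "z \<noteq> 0" using pos by (simp_all add: z_def)
  have other: "1 + \<tau> i * z \<noteq> 0" if "i \<noteq> j" for i
    using inj_nodes that pos by (auto simp: z_def field_simps inj_def)
  have "poly pade_num z = (\<Sum>i\<in>{j}. \<omega> i * (z * (\<Prod>k\<in>UNIV - {i}. 1 + \<tau> k * z)))"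
    unfolding pade_num_def poly_sum
    by (rule sum.mono_neutral_cong_right) (auto simp: poly_prod mult.commute[of z] z intro!: bexI[of _ j])
  also have "\<dots> \<noteq> 0"
    using weights_pos[of j] z other by auto
  finally have "poly pade_num z \<noteq> 0" .
  moreover have "poly [:1, \<tau> j:] z = 0" using z by (simp add: mult.commute)
  ultimately have "\<not> [:1, \<tau> j:] dvd pade_num"
    by (metis dvdE mult_zero_left poly_mult)
  then show "coprime pade_num [:1, \<tau> j:]"
    using prime_elem_linear_field_poly[of "\<tau> j" 1] pos
    by (subst coprime_commute) (intro prime_elem_imp_coprime)
qed

text \<open>
  The coefficient of \<open>x\<^sup>n\<^sup>+\<^sup>1\<close> in \<open>log (1 + x) - \<Sum>\<^sub>j \<omega>\<^sub>j x / (1 + \<tau>\<^sub>j x)\<close> is \<open>(-1)\<^sup>n\<close> times the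
  error of the quadrature rule on \<open>\<tau>\<^sup>n\<close>, which is \<open>0\<close> for \<open>n < 2 M\<close>.
\<close>
lemma is_pade_log_quadrature: "is_pade CARD('m) CARD('m) (fps_ln 1) (pade_num, pade_denom)"
proof -
  define G where "G j = Abs_fps (\<lambda>n. if n = 0 then 0 else (- \<tau> j) ^ (n - 1))" for j
  define S where "S = (\<Sum>j\<in>UNIV. fps_const (\<omega> j) * G j)"
  have G: "G j * fps_of_poly [:1, \<tau> j:] = fps_X" for j
  proof (rule fps_ext)
    fix n
    have linear: "fps_of_poly [:1, \<tau> j:] = 1 + fps_const (\<tau> j) * fps_X"
      by (simp add: fps_of_poly_pCons mult.commute)
    have "G j * fps_of_poly [:1, \<tau> j:] = G j + fps_const (\<tau> j) * (G j * fps_X)"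
      unfolding linear distrib_left mult_1_right by (simp only: ac_simps)
    then show "fps_nth (G j * fps_of_poly [:1, \<tau> j:]) n = fps_nth fps_X n"
      by (cases n; cases "n - 1") (auto simp: G_def)
  qed
  have "fps_of_poly pade_num = S * fps_of_poly pade_denom"
    unfolding S_def sum_distrib_right pade_num_def fps_of_poly_sum
  proof (rule sum.cong)
    fix j :: 'm
    have "fps_const (\<omega> j) * G j * fps_of_poly pade_denom
        = fps_const (\<omega> j) * (G j * fps_of_poly [:1, \<tau> j:]) * fps_of_poly (\<Prod>i\<in>UNIV - {j}. [:1, \<tau> i:])"
      unfolding pade_denom_remove[of j] fps_of_poly_mult by (simp only: mult.assoc)
    then show "fps_of_poly (smult (\<omega> j) ([:0, 1:] * (\<Prod>i\<in>UNIV - {j}. [:1, \<tau> i:])))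
        = fps_const (\<omega> j) * G j * fps_of_poly pade_denom"
      unfolding G by (auto simp: fps_of_poly_smult fps_of_poly_mult fps_of_poly_fps_X mult.assoc simp del: mult_pCons_left)
  qed simp
  then have "fps_ln 1 * fps_of_poly pade_denom - fps_of_poly pade_num = (fps_ln 1 - S) * fps_of_poly pade_denom"
    by (simp add: algebra_simps)
  moreover have "fps_nth (fps_ln 1 - S) k = 0" if "k \<le> 2 * CARD('m)" for k
  proof (cases k)
    case 0
    then show ?thesis by (simp add: fps_ln_nth S_def G_def fps_sum_nth)
  next
    case (Suc n)
    have "fps_nth (fps_ln 1 - S) k = (-1) ^ n / (real n + 1) - (\<Sum>j\<in>UNIV. \<omega> j * (- \<tau> j) ^ n)"
      by (simp add: Suc fps_ln_nth S_def G_def fps_sum_nth add.commute)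
    also have "\<dots> = (-1) ^ n * moment_defect n"
      by (simp add: moment_defect_def power_minus[of "\<tau> _"] right_diff_distrib sum_distrib_left mult_ac)
    also have "\<dots> = 0" using that Suc by (simp add: moment_defect_eq_0)
    finally show ?thesis .
  qed
  ultimately have "fps_nth (fps_ln 1 * fps_of_poly pade_denom - fps_of_poly pade_num) k = 0"
    if "k \<le> CARD('m) + CARD('m)" for k
    using that by (simp add: fps_mult_nth del: fps_sub_nth)
  moreover have "poly pade_denom 0 = 1" by (simp add: pade_denom_def poly_prod)
  ultimately show ?thesis
    unfolding is_pade_def by (auto simp: degree_pade_num degree_pade_denom coprime_pade)
qed

lemma pade_log_eq_quadrature:
  assumes "\<And>j. 1 + \<tau> j * x \<noteq> 0"
  shows "pade_log CARD('m) x = (\<Sum>j\<in>UNIV. \<omega> j * (x / (1 + \<tau> j * x)))"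
proof -
  have "(THE pq. is_pade CARD('m) CARD('m) (fps_ln 1) pq) = (pade_num, pade_denom)"
    by (rule the_equality) (use is_pade_log_quadrature is_pade_unique in auto)
  then show ?thesis by (simp add: pade_log_def poly_pade_quotient[OF assms])
qed

end

section \<open>The error of the rational approximation of the logarithm\<close>

text \<open>
  The inverse of \<open>1 + Y\<close> for \<open>\<parallel>Y\<parallel> < 1\<close>.
\<close>
definition neumann :: "'a::{real_normed_algebra_1,banach} \<Rightarrow> 'a" where
  "neumann Y = (\<Sum>n. (- Y) ^ n)"

definition quadrature_log ::
  "('m::finite \<Rightarrow> real) \<Rightarrow> ('m \<Rightarrow> real) \<Rightarrow> 'a::{real_normed_algebra_1,banach} \<Rightarrow> 'a" where
  "quadrature_log \<tau> \<omega> X = (\<Sum>j\<in>UNIV. \<omega> j *\<^sub>R (X * neumann (\<tau> j *\<^sub>R X)))"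

context gauss_unit
begin

lemma norm_node_scaled_less:
  fixes X :: "'a::real_normed_vector"
  shows "norm X < 1 \<Longrightarrow> norm (\<tau> j *\<^sub>R X) < 1"
  using mult_left_le_one_le[of "norm X" "\<tau> j"] nodes_pos[of j] nodes_less_1[of j] by auto

lemma log1p_minus_quadrature_sums:
  fixes X :: "'a::{real_normed_algebra_1,banach}"
  assumes "norm X < 1"
  shows "(\<lambda>n. ((-1) ^ n * moment_defect n) *\<^sub>R X ^ Suc n) sums (log1p_series X - quadrature_log \<tau> \<omega> X)"
proof -
  have pow: "(- (\<tau> j *\<^sub>R X)) ^ n = ((-1) ^ n * \<tau> j ^ n) *\<^sub>R X ^ n" for j n
    using scaleR_power[of "- \<tau> j" X n] by (simp add: power_minus[of "\<tau> j"])
  have "(\<lambda>n. (- (\<tau> j *\<^sub>R X)) ^ n) sums neumann (\<tau> j *\<^sub>R X)" for j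
    unfolding neumann_def using norm_node_scaled_less[OF assms, of j]
    by (intro summable_sums complete_algebra_summable_geometric) simp
  then have "(\<lambda>n. \<omega> j *\<^sub>R (X * (- (\<tau> j *\<^sub>R X)) ^ n)) sums (\<omega> j *\<^sub>R (X * neumann (\<tau> j *\<^sub>R X)))" for j
    by (intro sums_scaleR_right sums_mult)
  then have "(\<lambda>n. \<Sum>j\<in>UNIV. \<omega> j *\<^sub>R (X * (- (\<tau> j *\<^sub>R X)) ^ n)) sums quadrature_log \<tau> \<omega> X"
    unfolding quadrature_log_def by (intro sums_sum)
  then have "(\<lambda>n. ((-1) ^ n / (real n + 1)) *\<^sub>R X ^ Suc n - (\<Sum>j\<in>UNIV. \<omega> j *\<^sub>R (X * (- (\<tau> j *\<^sub>R X)) ^ n)))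
      sums (log1p_series X - quadrature_log \<tau> \<omega> X)"
    unfolding log1p_series_def by (intro sums_diff summable_sums summable_log1p_series assms)
  moreover have "((-1) ^ n / (real n + 1)) *\<^sub>R X ^ Suc n - (\<Sum>j\<in>UNIV. \<omega> j *\<^sub>R (X * (- (\<tau> j *\<^sub>R X)) ^ n))
      = ((-1) ^ n * moment_defect n) *\<^sub>R X ^ Suc n" for n
  proof -
    have "(\<Sum>j\<in>UNIV. \<omega> j *\<^sub>R (X * (- (\<tau> j *\<^sub>R X)) ^ n))
        = ((-1) ^ n * (\<Sum>j\<in>UNIV. \<omega> j * \<tau> j ^ n)) *\<^sub>R X ^ Suc n"
      by (simp add: pow sum_distrib_left scaleR_sum_left mult_ac)
    then show ?thesis
      by (simp add: moment_defect_def right_diff_distrib scaleR_diff_left del: power_Suc)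
  qed
  ultimately show ?thesis by (simp only:)
qed

text \<open>
  At a negative real number all terms of the error series have the same sign. Hence the sum of the norms
  of the terms at \<open>X\<close>, which dominates the error at \<open>X\<close>, is itself the error at \<open>- \<parallel>X\<parallel>\<close>.
\<close>
lemma norm_log1p_minus_quadrature_le:
  fixes X :: "'a::{real_normed_algebra_1,banach}"
  assumes "norm X < 1"
  shows "norm (log1p_series X - quadrature_log \<tau> \<omega> X)
    \<le> quadrature_log \<tau> \<omega> (- norm X) - log1p_series (- norm X)"
proof -
  have "(\<lambda>n. ((-1) ^ n * moment_defect n) *\<^sub>R (- norm X) ^ Suc n)
      sums (log1p_series (- norm X) - quadrature_log \<tau> \<omega> (- norm X))"
    using assms by (intro log1p_minus_quadrature_sums) simp
  from sums_minus[OF this]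
  have real_series: "(\<lambda>n. moment_defect n * norm X ^ Suc n)
      sums (quadrature_log \<tau> \<omega> (- norm X) - log1p_series (- norm X))"
    by (simp add: power_minus[of "norm X"] mult_ac)
  have le: "norm (((-1) ^ n * moment_defect n) *\<^sub>R X ^ Suc n) \<le> moment_defect n * norm X ^ Suc n" for n
    unfolding norm_scaleR using moment_defect_nonneg[of n] norm_power_ineq[of X "Suc n"]
    by (simp add: abs_mult power_abs mult_left_mono del: power_Suc)
  have "norm (log1p_series X - quadrature_log \<tau> \<omega> X)
      = norm (\<Sum>n. ((-1) ^ n * moment_defect n) *\<^sub>R X ^ Suc n)"
    using sums_unique[OF log1p_minus_quadrature_sums[OF assms]] by simp
  also have "\<dots> \<le> (\<Sum>n. moment_defect n * norm X ^ Suc n)"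
    using le sums_summable[OF real_series] by (intro norm_suminf_le)
  also have "\<dots> = quadrature_log \<tau> \<omega> (- norm X) - log1p_series (- norm X)"
    using sums_unique[OF real_series] by simp
  finally show ?thesis .
qed

lemma eps_pade_eq:
  assumes "opnorm (A - mat 1) < 1"
  shows "eps_pade CARD('m) A
    = \<bar>quadrature_log \<tau> \<omega> (- opnorm (A - mat 1)) - log1p_series (- opnorm (A - mat 1))\<bar>"
proof -
  define a where "a = opnorm (A - mat 1)"
  have a: "0 \<le> a" "a < 1" using assms by (simp_all add: a_def opnorm_nonneg)
  have lt: "\<tau> j * a < 1" for j
    using norm_node_scaled_less[of a j] a nodes_pos[of j] by simp
  have ne: "1 + \<tau> j * (- a) \<noteq> 0" for j using lt[of j] by simp
  have "neumann (\<tau> j *\<^sub>R (- a)) = 1 / (1 + \<tau> j * (- a))" for j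
    using geometric_series_inverse[of "\<tau> j * a"] lt[of j] ne[of j] a nodes_pos[of j]
    by (simp add: neumann_def field_simps)
  then have "quadrature_log \<tau> \<omega> (- a) = pade_log CARD('m) (- a)"
    by (simp add: quadrature_log_def pade_log_eq_quadrature[OF ne])
  moreover have "log1p_series (- a) = ln (1 - a)"
    using exp_log1p_series[of "- a"] a by (metis abs_minus_cancel abs_of_nonneg ln_exp real_norm_def uminus_add_conv_diff add.commute)
  ultimately show ?thesis by (simp add: eps_pade_def a_def)
qed

end

section \<open>The linear system and the output vector\<close>

lemma neumann_mult: "norm Y < 1 \<Longrightarrow> neumann Y * (1 + Y) = 1"
  for Y :: "'a::{real_normed_algebra_1,banach}"
  using geometric_series_inverse[of "- Y"] by (simp add: neumann_def)

lemma matrix_inv_eq_neumann: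
  assumes "norm Y < 1"
  shows "matrix_inv (mat_of Y + mat 1) = mat_of (neumann Y)"
proof -
  have "mat_of (neumann Y * (1 + Y)) = mat 1"
    using neumann_mult[OF assms] by (simp add: mat_of_simps)
  then have left: "mat_of (neumann Y) ** (mat_of Y + mat 1) = mat 1"
    by (simp add: mat_of_simps add.commute)
  then have right: "(mat_of Y + mat 1) ** mat_of (neumann Y) = mat 1"
    by (simp add: matrix_left_right_inverse)
  then have "(mat_of Y + mat 1) ** matrix_inv (mat_of Y + mat 1) = mat 1"
    using left unfolding matrix_inv_def by (metis (mono_tags, lifting) someI)
  then show ?thesis
    using left by (metis matrix_mul_assoc matrix_mul_lid matrix_mul_rid)
qed

lemma matrix_vector_mult_scaleR: "A *v (r *\<^sub>R v) = r *\<^sub>R (A *v v)" for v :: "complex ^ 'n"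
  by (simp add: vec_eq_iff matrix_vector_mult_def scaleR_sum_right)

lemma matrix_vector_mult_sum: "A *v (\<Sum>j\<in>S. f j) = (\<Sum>j\<in>S. A *v f j)"
  for f :: "_ \<Rightarrow> complex ^ 'n"
  by (rule linear_sum[OF bounded_linear.linear[OF matrix_vector_mul_bounded_linear]])

lemma norm_weighted_block_sum_le:
  fixes y :: "(complex ^ 'n) ^ 'm"
  shows "norm (\<Sum>j\<in>UNIV. \<omega> j *\<^sub>R (y $ j)) \<le> sqrt (\<Sum>j\<in>UNIV. \<bar>\<omega> j\<bar>\<^sup>2) * norm y"
proof -
  have "norm (\<Sum>j\<in>UNIV. \<omega> j *\<^sub>R (y $ j)) \<le> (\<Sum>j\<in>UNIV. \<bar>\<omega> j\<bar> * norm (y $ j))"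
    by (rule sum_norm_le) simp
  also have "\<dots> \<le> L2_set \<omega> UNIV * L2_set (\<lambda>j. norm (y $ j)) UNIV"
    using L2_set_mult_ineq[of \<omega> "\<lambda>j. norm (y $ j)" UNIV] by simp
  finally show ?thesis by (simp add: L2_set_def norm_vec_def)
qed

lemma output_vec_ket:
  "output_vec \<omega> A x = (A - mat 1) *v (\<Sum>j\<in>UNIV. \<omega> j *\<^sub>R (ket x $ j))"
  unfolding output_vec_def ket_def
  by (simp add: matrix_vector_mult_scaleR[symmetric] scaleR_sum_right divide_inverse_commute mult.commute)

lemma norm_output_vec_diff_le:
  "norm (output_vec \<omega> A x - output_vec \<omega> A x') \<le> delta_quad \<omega> A * norm (ket x - ket x')"
proof -
  have "output_vec \<omega> A x - output_vec \<omega> A x'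
      = (A - mat 1) *v (\<Sum>j\<in>UNIV. \<omega> j *\<^sub>R ((ket x - ket x') $ j))"
    unfolding output_vec_ket
    by (simp add: scaleR_diff_right sum_subtractf flip: matrix_vector_mult_diff_distrib)
  also have "norm \<dots> \<le> opnorm (A - mat 1) * norm (\<Sum>j\<in>UNIV. \<omega> j *\<^sub>R ((ket x - ket x') $ j))"
    by (rule norm_matrix_vector_le)
  also have "\<dots> \<le> opnorm (A - mat 1) * (sqrt (\<Sum>j\<in>UNIV. \<bar>\<omega> j\<bar>\<^sup>2) * norm (ket x - ket x'))"
    by (intro mult_left_mono norm_weighted_block_sum_le opnorm_nonneg)
  finally show ?thesis by (simp add: delta_quad_def mult.assoc)
qed

context gauss_unit
begin

lemma block_solution_nth:
  assumes "opnorm (A - mat 1) < 1"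
  shows "block_solution \<tau> A b $ j = mat_of (neumann (\<tau> j *\<^sub>R of_mat (A - mat 1))) *v b"
proof -
  have X: "mat_of (of_mat (A - mat 1)) = A - mat 1" by (simp add: of_mat_inverse)
  have "norm (of_mat (A - mat 1)) < 1" using assms by (metis X mat_of_simps(8))
  from matrix_inv_eq_neumann[OF norm_node_scaled_less[OF this, of j]]
  show ?thesis by (simp add: block_solution_def mat_of_simps X)
qed

lemma quadrature_of_block_solution:
  assumes "opnorm (A - mat 1) < 1"
  shows "(A - mat 1) *v (\<Sum>j\<in>UNIV. \<omega> j *\<^sub>R (block_solution \<tau> A b $ j))
    = mat_of (quadrature_log \<tau> \<omega> (of_mat (A - mat 1))) *v b"
proof -
  define X where "X = of_mat (A - mat 1)"
  have X: "mat_of X = A - mat 1" by (simp add: X_def of_mat_inverse)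
  have "mat_of (quadrature_log \<tau> \<omega> X) = (\<Sum>j\<in>UNIV. \<omega> j *\<^sub>R (mat_of X ** mat_of (neumann (\<tau> j *\<^sub>R X))))"
    unfolding quadrature_log_def
    by (simp add: linear_sum[OF bounded_linear.linear[OF bounded_linear_mat_of]] mat_of_simps)
  then show ?thesis
    unfolding block_solution_nth[OF assms] X_def[symmetric]
    unfolding X[symmetric]
    by (simp add: matrix_vector_mult_sum matrix_vector_mult_sum_left scaleR_matrix_vector
        matrix_vector_mult_scaleR matrix_vector_mul_assoc)
qed

lemma block_solution_solves:
  assumes a: "opnorm (A - mat 1) < 1"
  shows "(\<tau> j *\<^sub>R (A - mat 1) + mat 1) *v (block_solution \<tau> A b $ j) = b"
proof -
  define X where "X = of_mat (A - mat 1)"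
  have X: "mat_of X = A - mat 1" by (simp add: X_def of_mat_inverse)
  then have nX: "norm X < 1" using a by (metis mat_of_simps(8))
  have "mat_of (neumann (\<tau> j *\<^sub>R X)) ** (\<tau> j *\<^sub>R mat_of X + mat 1) = mat 1"
    using arg_cong[OF neumann_mult[OF norm_node_scaled_less[OF nX, of j]], of mat_of]
    by (simp add: mat_of_simps add.commute)
  then have "(\<tau> j *\<^sub>R mat_of X + mat 1) ** mat_of (neumann (\<tau> j *\<^sub>R X)) = mat 1"
    by (simp add: matrix_left_right_inverse)
  then show ?thesis
    unfolding block_solution_nth[OF a] X_def[symmetric]
    by (simp add: X matrix_vector_mul_assoc)
qed

text \<open>
  Each block satisfies \<open>y = b - \<tau>\<^sub>j X y\<close>, so \<open>\<parallel>y\<parallel> \<le> \<parallel>b\<parallel> + \<parallel>X\<parallel> \<parallel>y\<parallel>\<close>.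
\<close>
lemma norm_block_solution_le:
  assumes a: "opnorm (A - mat 1) < 1"
  shows "norm (block_solution \<tau> A b) \<le> sqrt (real CARD('m)) * (norm b / (1 - opnorm (A - mat 1)))"
proof -
  have "norm (block_solution \<tau> A b $ j) \<le> norm b / (1 - opnorm (A - mat 1))" for j
  proof -
    define y where "y = block_solution \<tau> A b $ j"
    have "(\<tau> j *\<^sub>R (A - mat 1) + mat 1) *v y = b"
      unfolding y_def by (rule block_solution_solves[OF a])
    then have "y = b - \<tau> j *\<^sub>R ((A - mat 1) *v y)"
      by (simp add: matrix_vector_mult_add_rdistrib scaleR_matrix_vector algebra_simps)
    then have "norm y \<le> norm b + norm (\<tau> j *\<^sub>R ((A - mat 1) *v y))"
      by (metis norm_triangle_ineq4)
    also have "norm (\<tau> j *\<^sub>R ((A - mat 1) *v y)) \<le> 1 * norm ((A - mat 1) *v y)"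
      unfolding norm_scaleR using nodes_pos[of j] nodes_less_1[of j] by (intro mult_right_mono) auto
    also have "\<dots> \<le> opnorm (A - mat 1) * norm y"
      using norm_matrix_vector_le[of "A - mat 1" y] by simp
    finally have "norm y * (1 - opnorm (A - mat 1)) \<le> norm b" by (simp add: algebra_simps)
    then show ?thesis using a by (simp add: y_def pos_le_divide_eq)
  qed
  then have "norm (block_solution \<tau> A b) \<le> L2_set (\<lambda>j::'m. norm b / (1 - opnorm (A - mat 1))) UNIV"
    unfolding norm_vec_def by (intro L2_set_mono) auto
  also have "\<dots> = sqrt (real CARD('m)) * (norm b / (1 - opnorm (A - mat 1)))"
    using a by (simp add: L2_set_def real_sqrt_mult)
  finally show ?thesis .
qed

lemma norm_quadrature_ge:
  assumes a: "opnorm (A - mat 1) < 1"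
  shows "norm (matrix_log A *v b) - eps_pade CARD('m) A * norm b
    \<le> norm ((A - mat 1) *v (\<Sum>j\<in>UNIV. \<omega> j *\<^sub>R (block_solution \<tau> A b $ j)))"
proof -
  define X where "X = of_mat (A - mat 1)"
  have X: "norm X = opnorm (A - mat 1)" by (metis X_def of_mat_inverse UNIV_I mat_of_simps(8))
  have "norm (matrix_log A *v b - mat_of (quadrature_log \<tau> \<omega> X) *v b)
      = norm (mat_of (log1p_series X - quadrature_log \<tau> \<omega> X) *v b)"
    unfolding matrix_log_eq_series[OF a] X_def[symmetric]
    by (simp add: mat_of_simps matrix_vector_mult_diff_rdistrib)
  also have "\<dots> \<le> norm (log1p_series X - quadrature_log \<tau> \<omega> X) * norm b"
    using norm_matrix_vector_le mat_of_simps(8) by metis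
  also have "\<dots> \<le> eps_pade CARD('m) A * norm b"
    using norm_log1p_minus_quadrature_le[of X] a
    by (intro mult_right_mono) (auto simp: eps_pade_eq[OF a] X)
  finally have "norm (matrix_log A *v b - mat_of (quadrature_log \<tau> \<omega> X) *v b)
      \<le> eps_pade CARD('m) A * norm b" .
  then show ?thesis
    using norm_triangle_ineq2[of "matrix_log A *v b" "mat_of (quadrature_log \<tau> \<omega> X) *v b"]
    unfolding quadrature_of_block_solution[OF a] X_def[symmetric] by linarith
qed

text \<open>
  The bound for \<open>\<parallel>x\<parallel>\<close> is an upper bound, so it may be inserted in the denominator only
  once the numerator \<open>\<parallel>log(A) b\<parallel> - \<epsilon>\<^sub>M \<parallel>b\<parallel>\<close> is known to be nonnegative; this is the purpose of the last
  hypothesis.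
\<close>
lemma norm_output_vec_ge:
  assumes a: "opnorm (A - mat 1) < 1" and "matrix_log A *v b \<noteq> 0"
    and x: "x = block_solution \<tau> A b"
    and K: "K = norm (matrix_log A *v ket b) * (1 - opnorm (A - mat 1))"
    and small: "eps_pade CARD('m) A \<le> K"
  shows "(K - eps_pade CARD('m) A) / sqrt (real CARD('m)) \<le> norm (output_vec \<omega> A x)"
proof -
  define e where "e = eps_pade CARD('m) A"
  define c where "c = 1 - opnorm (A - mat 1)"
  define l where "l = norm (matrix_log A *v b)"
  define m where "m = sqrt (real CARD('m))"
  have e: "0 \<le> e" by (simp add: e_def eps_pade_def)
  have c: "0 < c" "c \<le> 1" using a opnorm_nonneg[of "A - mat 1"] by (simp_all add: c_def)
  have b: "0 < norm b" using assms(2) by auto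
  have m: "0 < m" by (simp add: m_def)
  have K': "K = l * c / norm b"
    unfolding K l_def c_def ket_def by (simp add: matrix_vector_mult_scaleR divide_inverse_commute)
  have "l * c \<le> l * 1" using c by (intro mult_left_mono) (auto simp: l_def)
  then have "K \<le> l / norm b" using b by (simp add: K' divide_right_mono)
  then have diff: "0 \<le> l - e * norm b"
    using small b by (simp add: e_def[symmetric] pos_le_divide_eq) (metis mult_right_mono norm_ge_zero order.trans)
  have quad: "l - e * norm b \<le> norm ((A - mat 1) *v (\<Sum>j\<in>UNIV. \<omega> j *\<^sub>R (x $ j)))"
    using norm_quadrature_ge[OF a] by (simp add: x l_def e_def)
  have "x \<noteq> 0"
  proof
    assume "x = 0"
    then have "b = 0" using block_solution_solves[OF a, of undefined b] by (simp flip: x)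
    then show False using b by simp
  qed
  have x_le: "norm x \<le> m * (norm b / c)"
    using norm_block_solution_le[OF a, of b] by (simp add: x m_def c_def)
  have "(K - e) / m \<le> (l - e * norm b) / (m * (norm b / c))"
  proof -
    have "(l - e * norm b) / (m * (norm b / c)) = (K - e * c) / m"
      using b c m by (simp add: K' field_simps)
    moreover have "e * c \<le> e" using c e by (simp add: mult_left_le)
    ultimately show ?thesis using m by (simp add: divide_right_mono)
  qed
  also have "\<dots> \<le> (l - e * norm b) / norm x"
    using x_le diff \<open>x \<noteq> 0\<close> by (intro divide_left_mono) (auto intro!: mult_pos_pos divide_pos_pos b c m)
  also have "\<dots> \<le> norm ((A - mat 1) *v (\<Sum>j\<in>UNIV. \<omega> j *\<^sub>R (x $ j))) / norm x"
    by (intro divide_right_mono quad) simp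
  also have "\<dots> = norm (output_vec \<omega> A x)"
    by (simp add: output_vec_def)
  finally show ?thesis by (simp add: e_def m_def)
qed

end

theorem theorem5:
  fixes A :: "complex ^ 'n ^ 'n"
    and b :: "complex ^ 'n"
    and t s \<tau> \<omega> :: "'m::finite \<Rightarrow> real"
    and x x' :: "(complex ^ 'n) ^ 'm"
    and f f' :: "complex ^ 'n"
    and M :: nat
    and \<alpha> \<epsilon> \<epsilon>' K C :: real
  assumes "M = CARD('m)"
    and "opnorm (A - mat 1) < 1"
    and "matrix_log A *v b \<noteq> 0"
    and "\<alpha> > 0"
    and "opnorm (A /\<^sub>R \<alpha>) \<le> 1"
    and "gauss_legendre t s"
    and "\<And>j. \<tau> j = 1/2 * t j + 1/2"
    and "\<And>j. \<omega> j = 1/2 * s j"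
    and "C = 1 / Max (range \<omega>)"
    and "x = block_solution \<tau> A b"
    and "x' \<noteq> 0"
    and "f = target_vec A b x"
    and "f' = output_vec \<omega> A x'"
    and "f' \<noteq> 0"
    and "0 \<le> \<epsilon>'" and "\<epsilon>' \<le> 1/2"
    and "norm (ket x - ket x') \<le> \<epsilon>'"
    and "K = norm (matrix_log A *v ket b) * (1 - opnorm (A - mat 1))"
    and "\<epsilon> = 2 / K * (eps_pade M A + sqrt (real M) * delta_quad \<omega> A * \<epsilon>')"
    and "\<epsilon> \<le> 2"
    and "norm (ket f - ket f') \<le> \<epsilon>"
  shows "success_prob M C \<alpha> f' \<ge> (1 - \<epsilon> / 2)\<^sup>2 * (C * K / ((1 + \<alpha>) * real M))\<^sup>2"
proof -
  interpret gauss_unit \<tau> \<omega>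
    using assms(6-8) by (rule gauss_legendre_imp_gauss_unit)
  define a where "a = opnorm (A - mat 1)"
  define E where "E = eps_pade M A"
  define d where "d = delta_quad \<omega> A * \<epsilon>'"
  define m where "m = sqrt (real M)"
  have m: "0 < m" "m\<^sup>2 = real M" using assms(1) by (simp_all add: m_def)
  have E: "0 \<le> E" by (simp add: E_def eps_pade_def)
  have d: "0 \<le> d"
    using assms(15) by (simp add: d_def delta_quad_def opnorm_nonneg sum_nonneg)
  have "b \<noteq> 0" using assms(3) by auto
  then have "norm (matrix_log A *v ket b) > 0"
    using assms(3) by (simp add: ket_def matrix_vector_mult_scaleR)
  then have K: "0 < K" unfolding assms(18) using assms(2) by simp
  \<comment> \<open>\<open>\<epsilon>\<close> is scaled so that \<open>K \<epsilon> / 2\<close> is the total loss \<open>\<epsilon>\<^sub>M + \<surd>M \<delta> \<epsilon>'\<close>.\<close>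
  have K_eps: "K * (\<epsilon> / 2) = E + m * d"
    using K by (simp add: assms(19) E_def d_def m_def field_simps)
  have "K * (\<epsilon> / 2) \<le> K * 1" using K assms(20) by (intro mult_left_mono) auto
  then have "E \<le> K" using K_eps mult_nonneg_nonneg[of m d] m d by linarith
  then have "(K - E) / m \<le> norm (output_vec \<omega> A x)"
    using norm_output_vec_ge[OF assms(2,3,10,18)] by (simp add: E_def m_def assms(1))
  moreover have "norm (output_vec \<omega> A x - f') \<le> d"
  proof -
    have "norm (output_vec \<omega> A x - f') \<le> delta_quad \<omega> A * norm (ket x - ket x')"
      unfolding assms(13) by (rule norm_output_vec_diff_le)
    also have "\<dots> \<le> d"
      unfolding d_def using assms(17)
      by (intro mult_left_mono) (simp_all add: delta_quad_def opnorm_nonneg sum_nonneg)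
    finally show ?thesis .
  qed
  ultimately have "(K - E) / m - d \<le> norm f'"
    using norm_triangle_ineq2[of "output_vec \<omega> A x" f'] by linarith
  moreover have "(K - E) / m - d = (1 - \<epsilon> / 2) * K / m"
    using K_eps m(1) by (simp add: field_simps)
  ultimately have f': "(1 - \<epsilon> / 2) * K / m \<le> norm f'" by simp
  have "0 \<le> (1 - \<epsilon> / 2) * K / m" using K m(1) assms(20) by simp
  then have "((1 - \<epsilon> / 2) * K / m)\<^sup>2 \<le> (norm f')\<^sup>2"
    using f' by (intro power_mono)
  then have "C\<^sup>2 / ((1 + \<alpha>)\<^sup>2 * real M) * ((1 - \<epsilon> / 2) * K / m)\<^sup>2 \<le> success_prob M C \<alpha> f'"
    unfolding success_prob_def by (intro mult_left_mono) auto
  moreover have "C\<^sup>2 / ((1 + \<alpha>)\<^sup>2 * real M) * ((1 - \<epsilon> / 2) * K / m)\<^sup>2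
      = (1 - \<epsilon> / 2)\<^sup>2 * (C * K / ((1 + \<alpha>) * real M))\<^sup>2"
    by (simp add: power_divide power_mult_distrib m(2)) (simp add: power2_eq_square mult_ac)
  ultimately show ?thesis by simp
qed

end
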